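(* Let $\{P_\alpha,Q_\alpha\}_{\alpha=0}^M$ be pairs of canonically conjugate functions, and let $\mathbb{F}:=(F_0(z_0,m_0),\dots,F_M(z_M,m_M))$ be a vector function, each $F_\alpha$ being a function of two variables. Then the infinitesimal deformation $$\delta_{\mathbb F}P_\alpha:=\{F_\alpha,P_\alpha\},\qquad \delta_{\mathbb F}Q_\alpha:=\{F_\alpha,Q_\alpha\},$$ $$\delta_{\mathbb F}z_\alpha:=\{z_\alpha,(F_\alpha)_-\},\qquad \delta_{\mathbb F}m_\alpha:=\{m_\alpha,(F_\alpha)_-\},$$ where $$(F_\alpha)_-:=F_\alpha-\sum_{\beta=0}^M(F_\beta)_{(\beta,+)},$$ determines a symmetry of the system of string equations $$P_i(z_i,m_i)=P_0(z_0,m_0),\qquad Q_i(z_i,m_i)=Q_0(z_0,m_0),\qquad i=1,\dots,M.$$ That is: for every solution $(z_\alpha,m_\alpha)_{\alpha=0}^M$ of this system one has, at first order in $\epsilon$ (i.e. modulo $O(\epsilon^2)$), for all $i=1,\dots,M$, $$(P_i+\epsilon\,\delta_{\mathbb F}P_i)(z_i+\epsilon\,\delta_{\mathbb F}z_i,\,m_i+\epsilon\,\delta_{\mathbb F}m_i)=(P_0+\epsilon\,\delta_{\mathbb F}P_0)(z_0+\epsilon\,\delta_{\mathbb F}z_0,\,m_0+\epsilon\,\delta_{\mathbb F}m_0),$$ $$(Q_i+\epsilon\,\delta_{\mathbb F}Q_i)(z_i+\epsilon\,\delta_{\mathbb F}z_i,\,m_i+\epsilon\,\delta_{\mathbb F}m_i)=(Q_0+\epsilon\,\delta_{\mathbb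 F}Q_0)(z_0+\epsilon\,\delta_{\mathbb F}z_0,\,m_0+\epsilon\,\delta_{\mathbb F}m_0).$$
   Context: Greek indices run over $\{0,\dots,M\}$, Latin indices over $\{1,\dots,M\}$. Punctures: $q_0:=\infty$ and points $q_1,\dots,q_M$ in the complex $p$-plane. The dynamical variables $(z_\alpha,m_\alpha)$ are functions of $p$ and of times $\boldsymbol{t}=\{t_{0n}\}_{n\ge1}\cup\{t_{in}\}_{n\ge0}$ with $x:=t_{01}$, having expansions $z_0=p+\sum_{n\ge1}d_{0n}p^{-n}$ at $p=\infty$, $z_i=\frac{d_i}{p-q_i}+\sum_{n\ge0}d_{in}(p-q_i)^n$ at $p=q_i$, and $m_\alpha=\sum_{n\ge1}n\,t_{\alpha n}z_\alpha^{n-1}+t_{\alpha0}z_\alpha^{-1}+\sum_{n\ge2}v_{\alpha n}z_\alpha^{-n}$ with $t_{00}:=-\sum_{i=1}^Mt_{i0}$, the coefficients $q_i,d_i,d_{\alpha n},v_{\alpha n}$ depending on $\boldsymbol{t}$. They satisfy $\{z_\alpha,m_\alpha\}=1$ for all $\alpha$. Poisson bracket: $\{F,G\}:=\frac{\partial F}{\partial p}\frac{\partial G}{\partial x}-\frac{\partial F}{\partial x}\frac{\partial G}{\partial p}$. "Canonically conjugate" means $\{P_\alpha(p,x),Q_\alpha(p,x)\}=1$. In $\delta_{\mathbb F}P_\alpha$, $\delta_{\mathbb F}Q_\alpha$ the functions $F_\alpha,P_\alpha,Q_\alpha$ are regarded as functions of the two canonical variables $(z_\alpha,m_\alpha)$,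 with $\{F,G\}=\frac{\partial F}{\partial z_\alpha}\frac{\partial G}{\partial m_\alpha}-\frac{\partial F}{\partial m_\alpha}\frac{\partial G}{\partial z_\alpha}$; since $\{z_\alpha,m_\alpha\}=1$, this agrees with the bracket in $(p,x)$ of the composed functions. In $\delta_{\mathbb F}z_\alpha$, $\delta_{\mathbb F}m_\alpha$ everything is regarded as a function of $(p,\boldsymbol{t})$. Projectors: $(\cdot)_{(0,+)}$ is the projection of Laurent series at $p=\infty$ onto the span of $\{p^n\}_{n\ge0}$, and $(\cdot)_{(i,+)}$ is the projection of Laurent series at $p=q_i$ onto the span of $\{(p-q_i)^{-n}\}_{n\ge1}$; $(F_\beta)_{(\beta,+)}$ is the projection applied to the Laurent series of $F_\beta(z_\beta(p,\boldsymbol{t}),m_\beta(p,\boldsymbol{t}))$ at $q_\beta$. The string equations are understood as equalities of functions of $(p,\boldsymbol{t})$ (after analytic continuation in $p$ where needed). *)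

theory Defs
  imports "HOL-Complex_Analysis.Complex_Analysis" "HOL-Library.Landau_Symbols"
begin

section \<open>Holomorphic functions of two variables and the Poisson bracket\<close>

definition holomorphic2_at :: "(complex \<Rightarrow> complex \<Rightarrow> complex) \<Rightarrow> complex \<Rightarrow> complex \<Rightarrow> bool" where
  "holomorphic2_at f u v \<longleftrightarrow>
     (\<exists>a b. ((\<lambda>w. f (fst w) (snd w)) has_derivative (\<lambda>h. a * fst h + b * snd h)) (at (u, v)))"

text \<open>Complex Frechet differentiability; only used on open sets, where it is holomorphy in
  two variables.\<close>

definition holomorphic2_on :: "(complex \<Rightarrow> complex \<Rightarrow> complex) \<Rightarrow> (complex \<times> complex) set \<Rightarrow> bool" where
  "holomorphic2_on f W \<longleftrightarrow> (\<forall>(u, v) \<in> W. holomorphic2_at f u v)"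

definition poisson ::
  "(complex \<Rightarrow> complex \<Rightarrow> complex) \<Rightarrow> (complex \<Rightarrow> complex \<Rightarrow> complex) \<Rightarrow> complex \<Rightarrow> complex \<Rightarrow> complex" where
  "poisson f g u v =
     deriv (\<lambda>s. f s v) u * deriv (\<lambda>s. g u s) v - deriv (\<lambda>s. f u s) v * deriv (\<lambda>s. g s v) u"

definition canonically_conjugate ::
  "(complex \<times> complex) set \<Rightarrow> (complex \<Rightarrow> complex \<Rightarrow> complex) \<Rightarrow> (complex \<Rightarrow> complex \<Rightarrow> complex) \<Rightarrow> bool" where
  "canonically_conjugate W P Q \<longleftrightarrow>
     holomorphic2_on P W \<and> holomorphic2_on Q W \<and> (\<forall>(u, v) \<in> W. poisson P Q u v = 1)"

section \<open>Functions of $p$ and of the times\<close>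

text \<open>\<open>t \<alpha> n\<close> is the time $t_{\alpha n}$. The bracket only differentiates in $p$ and
  $x = t_{01}$, so regularity and openness are only required in $(p,x)$, the other times being
  parameters.\<close>

type_synonym times = "nat \<Rightarrow> nat \<Rightarrow> complex"

definition with_x :: "times \<Rightarrow> complex \<Rightarrow> times" where
  "with_x t x = t(0 := (t 0)(1 := x))"

definition px_open :: "(complex \<times> times) set \<Rightarrow> bool" where
  "px_open \<Omega> \<longleftrightarrow> (\<forall>t. open {(p, x). (p, with_x t x) \<in> \<Omega>})"

definition px_holomorphic_on :: "(complex \<Rightarrow> times \<Rightarrow> complex) \<Rightarrow> (complex \<times> times) set \<Rightarrow> bool" where
  "px_holomorphic_on f \<Omega> \<longleftrightarrow>
     (\<forall>(p, t) \<in> \<Omega>. holomorphic2_at (\<lambda>p' x. f p' (with_x t x)) p (t 0 1))"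

definition px_poisson ::
  "(complex \<Rightarrow> times \<Rightarrow> complex) \<Rightarrow> (complex \<Rightarrow> times \<Rightarrow> complex) \<Rightarrow> complex \<Rightarrow> times \<Rightarrow> complex" where
  "px_poisson f g p t =
     poisson (\<lambda>p' x. f p' (with_x t x)) (\<lambda>p' x. g p' (with_x t x)) p (t 0 1)"

section \<open>Laurent series and projectors\<close>

text \<open>Laurent series are taken on annuli. An inner radius \<open>0\<close> at a finite puncture $q_i$, and an
  outer radius \<open>\<infinity>\<close> around the centre \<open>0\<close> for the puncture $q_0 = \infty$, give Laurent series on
  a punctured neighbourhood of the puncture. Other radii are needed when the series
  $\sum_n n t_{\alpha n} z_\alpha^{n-1}$ has a finite radius of convergence.\<close>

definition annulus :: "complex \<Rightarrow> real \<Rightarrow> ereal \<Rightarrow> complex set" where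
  "annulus c r R = {p. r < norm (p - c) \<and> ereal (norm (p - c)) < R}"

definition laurent_series_on :: "(complex \<Rightarrow> complex) \<Rightarrow> complex \<Rightarrow> complex set \<Rightarrow> (int \<Rightarrow> complex) \<Rightarrow> bool" where
  "laurent_series_on f c A a \<longleftrightarrow> (\<forall>p \<in> A. ((\<lambda>k. a k * (p - c) powi k) has_sum f p) UNIV)"

definition laurent_coeffs :: "(complex \<Rightarrow> complex) \<Rightarrow> complex \<Rightarrow> complex set \<Rightarrow> int \<Rightarrow> complex" where
  "laurent_coeffs f c A = (THE a. laurent_series_on f c A a)"

text \<open>Centre of the annulus belonging to $q_\alpha$; the value \<open>q 0\<close> is never used.\<close>

definition centre :: "(nat \<Rightarrow> times \<Rightarrow> complex) \<Rightarrow> nat \<Rightarrow> times \<Rightarrow> complex" where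
  "centre q \<alpha> t = (if \<alpha> = 0 then 0 else q \<alpha> t)"

abbreviation annulus_at ::
  "(nat \<Rightarrow> times \<Rightarrow> complex) \<Rightarrow> (nat \<Rightarrow> times \<Rightarrow> real) \<Rightarrow> (nat \<Rightarrow> times \<Rightarrow> ereal) \<Rightarrow> nat \<Rightarrow> times \<Rightarrow> complex set" where
  "annulus_at q r R \<alpha> t \<equiv> annulus (centre q \<alpha> t) (r \<alpha> t) (R \<alpha> t)"

definition plus_part ::
  "(nat \<Rightarrow> times \<Rightarrow> complex) \<Rightarrow> (nat \<Rightarrow> times \<Rightarrow> real) \<Rightarrow> (nat \<Rightarrow> times \<Rightarrow> ereal) \<Rightarrow> nat \<Rightarrow>
     (complex \<Rightarrow> times \<Rightarrow> complex) \<Rightarrow> complex \<Rightarrow> times \<Rightarrow> complex" where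
  "plus_part q r R \<alpha> f p t =
     (let a = laurent_coeffs (\<lambda>p'. f p' t) (centre q \<alpha> t) (annulus_at q r R \<alpha> t)
      in if \<alpha> = 0 then (\<Sum>n. a (int n) * p ^ n)
         else (\<Sum>n. a (- int (Suc n)) * inverse (p - q \<alpha> t) ^ Suc n))"

text \<open>The domain of \<open>plus_part q r R \<alpha> f\<close> at fixed times: the plane, respectively the plane without
  $q_\alpha$, when the Laurent series lives on a punctured neighbourhood of the puncture.\<close>

definition plus_region ::
  "(nat \<Rightarrow> times \<Rightarrow> complex) \<Rightarrow> (nat \<Rightarrow> times \<Rightarrow> real) \<Rightarrow> (nat \<Rightarrow> times \<Rightarrow> ereal) \<Rightarrow> nat \<Rightarrow> times \<Rightarrow> complex set" where
  "plus_region q r R \<alpha> t =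
     (if \<alpha> = 0 then {p. ereal (norm p) < R 0 t} else {p. r \<alpha> t < norm (p - q \<alpha> t)})"

section \<open>The dynamical variables\<close>

text \<open>\<open>T\<close> is the set of admissible times, \<open>\<Omega> \<alpha>\<close> the domain of \<open>z \<alpha>\<close> and \<open>m \<alpha>\<close>. In
  \<open>whitham_expansions\<close>, \<open>d \<alpha> n\<close> is $d_{\alpha n}$, \<open>e i\<close> is $d_i$ and \<open>v \<alpha> n\<close> is $v_{\alpha n}$.
  The condition \<open>z \<alpha> p t \<noteq> 0\<close> makes the negative powers of $z_\alpha$ meaningful.\<close>

definition whitham_expansions ::
  "nat \<Rightarrow> times set \<Rightarrow> (nat \<Rightarrow> times \<Rightarrow> complex) \<Rightarrow> (nat \<Rightarrow> times \<Rightarrow> real) \<Rightarrow> (nat \<Rightarrow> times \<Rightarrow> ereal) \<Rightarrow>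
     (nat \<Rightarrow> complex \<Rightarrow> times \<Rightarrow> complex) \<Rightarrow> (nat \<Rightarrow> complex \<Rightarrow> times \<Rightarrow> complex) \<Rightarrow> bool" where
  "whitham_expansions M T q r R z m \<longleftrightarrow>
     (\<exists>(d :: nat \<Rightarrow> nat \<Rightarrow> times \<Rightarrow> complex) (e :: nat \<Rightarrow> times \<Rightarrow> complex)
        (v :: nat \<Rightarrow> nat \<Rightarrow> times \<Rightarrow> complex).
        \<forall>t \<in> T.
          (\<forall>p \<in> annulus_at q r R 0 t.
             (\<lambda>n. d 0 (Suc n) t * inverse p ^ Suc n) sums (z 0 p t - p)) \<and>
          (\<forall>i \<in> {1..M}. \<forall>p \<in> annulus_at q r R i t.
             (\<lambda>n. d i n t * (p - q i t) ^ n) sums (z i p t - e i t / (p - q i t))) \<and>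
          (\<forall>\<alpha> \<le> M. \<forall>p \<in> annulus_at q r R \<alpha> t.
             z \<alpha> p t \<noteq> 0 \<and>
             summable (\<lambda>n. of_nat (Suc n) * t \<alpha> (Suc n) * z \<alpha> p t ^ n) \<and>
             summable (\<lambda>n. v \<alpha> (n + 2) t * inverse (z \<alpha> p t) ^ (n + 2)) \<and>
             m \<alpha> p t =
               (\<Sum>n. of_nat (Suc n) * t \<alpha> (Suc n) * z \<alpha> p t ^ n)
               + t \<alpha> 0 * inverse (z \<alpha> p t)
               + (\<Sum>n. v \<alpha> (n + 2) t * inverse (z \<alpha> p t) ^ (n + 2))))"

definition whitham_variables ::
  "nat \<Rightarrow> times set \<Rightarrow> (nat \<Rightarrow> times \<Rightarrow> complex) \<Rightarrow> (nat \<Rightarrow> times \<Rightarrow> real) \<Rightarrow> (nat \<Rightarrow> times \<Rightarrow> ereal) \<Rightarrow>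
     (nat \<Rightarrow> (complex \<times> times) set) \<Rightarrow>
     (nat \<Rightarrow> complex \<Rightarrow> times \<Rightarrow> complex) \<Rightarrow> (nat \<Rightarrow> complex \<Rightarrow> times \<Rightarrow> complex) \<Rightarrow> bool" where
  "whitham_variables M T q r R \<Omega> z m \<longleftrightarrow>
     (\<forall>t \<in> T. t 0 0 = - (\<Sum>i = 1..M. t i 0)) \<and>
     (\<forall>i \<in> {1..M}. \<forall>t \<in> T. (\<lambda>x. q i (with_x t x)) field_differentiable at (t 0 1)) \<and>
     (\<forall>\<alpha> \<le> M. \<forall>t \<in> T. 0 \<le> r \<alpha> t \<and> ereal (r \<alpha> t) < R \<alpha> t) \<and>
     (\<forall>\<alpha> \<le> M. px_open {(p, t). t \<in> T \<and> p \<in> annulus_at q r R \<alpha> t}) \<and>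
     (\<forall>\<alpha> \<le> M. {(p, t). t \<in> T \<and> p \<in> annulus_at q r R \<alpha> t} \<subseteq> \<Omega> \<alpha> \<and>
               \<Omega> \<alpha> \<subseteq> UNIV \<times> T \<and> px_open (\<Omega> \<alpha>)) \<and>
     (\<forall>\<alpha> \<le> M. px_holomorphic_on (z \<alpha>) (\<Omega> \<alpha>) \<and> px_holomorphic_on (m \<alpha>) (\<Omega> \<alpha>)) \<and>
     whitham_expansions M T q r R z m \<and>
     (\<forall>\<alpha> \<le> M. \<forall>(p, t) \<in> \<Omega> \<alpha>. px_poisson (z \<alpha>) (m \<alpha>) p t = 1)"

section \<open>String equations\<close>

text \<open>Domains in which identities between functions defined near different punctures are read.
  Connectedness of the slices makes analytic continuation in $p$ unique.\<close>

definition continuation_domain ::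
  "nat \<Rightarrow> times set \<Rightarrow> (nat \<Rightarrow> times \<Rightarrow> complex) \<Rightarrow> (nat \<Rightarrow> times \<Rightarrow> real) \<Rightarrow> (nat \<Rightarrow> times \<Rightarrow> ereal) \<Rightarrow>
     (nat \<Rightarrow> (complex \<times> times) set) \<Rightarrow> (complex \<times> times) set \<Rightarrow> bool" where
  "continuation_domain M T q r R \<Omega> D \<longleftrightarrow>
     px_open D \<and> D \<subseteq> UNIV \<times> T \<and>
     (\<forall>t \<in> T. connected {p. (p, t) \<in> D}) \<and>
     (\<forall>\<alpha> \<le> M. \<Omega> \<alpha> \<subseteq> D) \<and>
     (\<forall>\<alpha> \<le> M. \<forall>(p, t) \<in> D. p \<in> plus_region q r R \<alpha> t)"

text \<open>\<open>f\<close> on \<open>A\<close> and \<open>g\<close> on \<open>B\<close> are restrictions of one function on \<open>D\<close>.\<close>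

definition equal_by_continuation ::
  "(complex \<times> times) set \<Rightarrow> (complex \<times> times) set \<Rightarrow> (complex \<Rightarrow> times \<Rightarrow> complex) \<Rightarrow>
     (complex \<times> times) set \<Rightarrow> (complex \<Rightarrow> times \<Rightarrow> complex) \<Rightarrow> bool" where
  "equal_by_continuation D A f B g \<longleftrightarrow>
     (\<exists>H. px_holomorphic_on H D \<and>
          (\<forall>(p, t) \<in> A. f p t = H p t) \<and> (\<forall>(p, t) \<in> B. g p t = H p t))"

text \<open>The same for families depending on \<open>\<epsilon>\<close>, modulo $O(\epsilon^2)$.\<close>

definition equal_to_first_order ::
  "(complex \<times> times) set \<Rightarrow> (complex \<times> times) set \<Rightarrow> (complex \<Rightarrow> complex \<Rightarrow> times \<Rightarrow> complex) \<Rightarrow>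
     (complex \<times> times) set \<Rightarrow> (complex \<Rightarrow> complex \<Rightarrow> times \<Rightarrow> complex) \<Rightarrow> bool" where
  "equal_to_first_order D A f B g \<longleftrightarrow>
     (\<exists>H0 H1. px_holomorphic_on H0 D \<and> px_holomorphic_on H1 D \<and>
        (\<forall>(p, t) \<in> A. (\<lambda>\<epsilon>. f \<epsilon> p t - (H0 p t + \<epsilon> * H1 p t)) \<in> O[at 0](\<lambda>\<epsilon>. \<epsilon> ^ 2)) \<and>
        (\<forall>(p, t) \<in> B. (\<lambda>\<epsilon>. g \<epsilon> p t - (H0 p t + \<epsilon> * H1 p t)) \<in> O[at 0](\<lambda>\<epsilon>. \<epsilon> ^ 2)))"

definition string_equations ::
  "nat \<Rightarrow> (complex \<times> times) set \<Rightarrow> (nat \<Rightarrow> (complex \<times> times) set) \<Rightarrow>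
     (nat \<Rightarrow> complex \<Rightarrow> times \<Rightarrow> complex) \<Rightarrow> (nat \<Rightarrow> complex \<Rightarrow> times \<Rightarrow> complex) \<Rightarrow>
     (nat \<Rightarrow> complex \<Rightarrow> complex \<Rightarrow> complex) \<Rightarrow> (nat \<Rightarrow> complex \<Rightarrow> complex \<Rightarrow> complex) \<Rightarrow> bool" where
  "string_equations M D \<Omega> z m P Q \<longleftrightarrow>
     (\<forall>i \<in> {1..M}.
        equal_by_continuation D (\<Omega> i) (\<lambda>p t. P i (z i p t) (m i p t))
                                (\<Omega> 0) (\<lambda>p t. P 0 (z 0 p t) (m 0 p t)) \<and>
        equal_by_continuation D (\<Omega> i) (\<lambda>p t. Q i (z i p t) (m i p t))
                                (\<Omega> 0) (\<lambda>p t. Q 0 (z 0 p t) (m 0 p t)))"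

section \<open>The deformation\<close>

definition minus_part ::
  "nat \<Rightarrow> (nat \<Rightarrow> times \<Rightarrow> complex) \<Rightarrow> (nat \<Rightarrow> times \<Rightarrow> real) \<Rightarrow> (nat \<Rightarrow> times \<Rightarrow> ereal) \<Rightarrow>
     (nat \<Rightarrow> complex \<Rightarrow> times \<Rightarrow> complex) \<Rightarrow> (nat \<Rightarrow> complex \<Rightarrow> times \<Rightarrow> complex) \<Rightarrow>
     (nat \<Rightarrow> complex \<Rightarrow> complex \<Rightarrow> complex) \<Rightarrow> nat \<Rightarrow> complex \<Rightarrow> times \<Rightarrow> complex" where
  "minus_part M q r R z m F \<alpha> p t =
     F \<alpha> (z \<alpha> p t) (m \<alpha> p t)
     - (\<Sum>\<beta> \<le> M. plus_part q r R \<beta> (\<lambda>p' t'. F \<beta> (z \<beta> p' t') (m \<beta> p' t')) p t)"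

text \<open>\<open>deformed M q r R z m F P \<alpha> \<epsilon>\<close> is
  $(P_\alpha+\epsilon\,\delta_F P_\alpha)(z_\alpha+\epsilon\,\delta_F z_\alpha,
    m_\alpha+\epsilon\,\delta_F m_\alpha)$ as a function of $(p,t)$.\<close>

definition deformed ::
  "nat \<Rightarrow> (nat \<Rightarrow> times \<Rightarrow> complex) \<Rightarrow> (nat \<Rightarrow> times \<Rightarrow> real) \<Rightarrow> (nat \<Rightarrow> times \<Rightarrow> ereal) \<Rightarrow>
     (nat \<Rightarrow> complex \<Rightarrow> times \<Rightarrow> complex) \<Rightarrow> (nat \<Rightarrow> complex \<Rightarrow> times \<Rightarrow> complex) \<Rightarrow>
     (nat \<Rightarrow> complex \<Rightarrow> complex \<Rightarrow> complex) \<Rightarrow> (nat \<Rightarrow> complex \<Rightarrow> complex \<Rightarrow> complex) \<Rightarrow>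
     nat \<Rightarrow> complex \<Rightarrow> complex \<Rightarrow> times \<Rightarrow> complex" where
  "deformed M q r R z m F P \<alpha> \<epsilon> p t =
     (let Fm = minus_part M q r R z m F \<alpha>;
          u = z \<alpha> p t + \<epsilon> * px_poisson (z \<alpha>) Fm p t;
          w = m \<alpha> p t + \<epsilon> * px_poisson (m \<alpha>) Fm p t
      in P \<alpha> u w + \<epsilon> * poisson (F \<alpha>) (P \<alpha>) u w)"

end

theory Submission
  imports Defs
begin

text \<open>Let $S = \sum_\beta (F_\beta)_{(\beta,+)}$, so that $(F_\alpha)_- = F_\alpha - S$. Since
  $\{z_\alpha, m_\alpha\} = 1$, the chain rule turns the coefficient of $\epsilon$ in the deformed
  $P_\alpha$ into $\{P_\alpha, F_\alpha - S\} + \{F_\alpha, P_\alpha\} = \{S, P_\alpha\}$, and this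
  depends on $\alpha$ only through the common value of the $P_\alpha(z_\alpha, m_\alpha)$. What remains is
  analysis: $S$ is holomorphic in $(p, x)$, because each projection is a Cauchy integral over a circle
  around the (moving) puncture, and brackets of holomorphic functions are holomorphic.\<close>

section \<open>Holomorphic functions of two variables\<close>

text \<open>\<open>holomorphic2_at\<close> only asserts a Frechet derivative at a point, whereas
  nested brackets and an error O(\<epsilon>^2) need control of higher derivatives. Hence the detour
  through the equivalence with "continuous and separately holomorphic", where Cauchy's formula over
  a fixed circle trades derivatives for integrals over [0,1] with parameters. The projections are
  built on coefficients given by a definite description, so the Laurent expansion in an annulus must
  be shown to exist and to be unique before they can be evaluated. A further obstacle is that the
  annuli move with x and that their radii are arbitrary functions of the times: openness of the
  family of annuli lets one radius \<rho> serve all nearby x, and parametrising the circle from its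
  centre shifts the motion into the integrand. Finally, the two sides live on different domains and
  meet only in a continuation H to D; the first-order term must therefore be holomorphic on all of
  D, which is why the contour formula is proved also for p outside the annulus.\<close>

lemma circlepath_integral_01:
  "contour_integral (circlepath c \<rho>) f =
     integral (cbox 0 1) (\<lambda>\<theta>. f (circlepath c \<rho> \<theta>) * (2 * of_real pi * \<i> * (circlepath c \<rho> \<theta> - c)))"
  unfolding contour_integral_integral vector_derivative_circlepath by (simp add: circlepath mult_ac)

lemma continuous_on_circlepath [continuous_intros]:
  assumes "continuous_on A h" "continuous_on A c"
  shows "continuous_on A (\<lambda>x. circlepath (c x) \<rho> (h x))"
  unfolding circlepath by (intro continuous_intros assms)

lemma circlepath_norm:
  "0 \<le> \<rho> \<Longrightarrow> norm (circlepath c \<rho> \<theta> - c) = \<rho>"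
  by (simp add: circlepath norm_mult)

text \<open>Separates a moving centre from a fixed circle, so that the dependence on the centre can
  be read off the integrand.\<close>

lemma circlepath_shift: "circlepath c \<rho> \<theta> = c + circlepath 0 \<rho> \<theta>"
  by (simp add: circlepath)

text \<open>Near \<open>u0\<close> the derivative is a Cauchy integral over one fixed circle around
  \<open>u0\<close>, and the integrand is jointly continuous because u stays inside the circle. The
  parameter set \<open>Y\<close> is arbitrary, so that compact integration intervals and open sets
  are both covered.\<close>

lemma continuous_on_deriv_param:
  fixes g :: "complex \<Rightarrow> 'b::t2_space \<Rightarrow> complex"
  assumes S: "open S" and cont: "continuous_on (S \<times> Y) (\<lambda>x. g (fst x) (snd x))"
    and hol: "\<And>y. y \<in> Y \<Longrightarrow> (\<lambda>u. g u y) holomorphic_on S"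
  shows "continuous_on (S \<times> Y) (\<lambda>x. deriv (\<lambda>u. g u (snd x)) (fst x))"
  unfolding continuous_on_eq_continuous_within
proof
  fix x0 assume "x0 \<in> S \<times> Y"
  then obtain u0 y0 where x0: "x0 = (u0, y0)" "u0 \<in> S" "y0 \<in> Y" by auto
  then obtain \<rho> where \<rho>: "\<rho> > 0" "cball u0 \<rho> \<subseteq> S"
    using S open_contains_cball by blast
  let ?\<gamma> = "circlepath u0 \<rho>"
  \<comment> \<open>The Cauchy integrand for the first derivative, pulled back to [0,1]; the last
    factor is the velocity of the circle.\<close>
  define I where "I x \<theta> = g (?\<gamma> \<theta>) (snd x) / (?\<gamma> \<theta> - fst x)^2 * (2 * of_real pi * \<i> * (?\<gamma> \<theta> - u0))" for x \<theta>
  have mem: "?\<gamma> \<theta> \<in> S" "u \<in> ball u0 \<rho> \<Longrightarrow> ?\<gamma> \<theta> \<noteq> u" for \<theta> u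
  proof -
    have n: "norm (?\<gamma> \<theta> - u0) = \<rho>" using \<rho> circlepath_norm by simp
    then have "dist u0 (?\<gamma> \<theta>) = \<rho>" by (simp add: dist_norm norm_minus_commute)
    then show "?\<gamma> \<theta> \<in> S" using \<rho> by (auto simp: subset_iff)
    show "u \<in> ball u0 \<rho> \<Longrightarrow> ?\<gamma> \<theta> \<noteq> u" using n by (auto simp: dist_norm norm_minus_commute)
  qed
  have "continuous_on ((ball u0 \<rho> \<times> Y) \<times> cbox (0::real) 1) (\<lambda>z. g (?\<gamma> (snd z)) (snd (fst z)))"
    by (rule continuous_on_compose2[OF cont, where f = "\<lambda>z. (?\<gamma> (snd z), snd (fst z))", simplified])
      (use mem in \<open>auto intro!: continuous_intros\<close>)
  then have "continuous_on ((ball u0 \<rho> \<times> Y) \<times> cbox (0::real) 1) (\<lambda>(x, \<theta>). I x \<theta>)"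
    unfolding I_def split_beta by (intro continuous_intros) (use mem in auto)
  then have "continuous_on (ball u0 \<rho> \<times> Y) (\<lambda>x. 1 / (2 * of_real pi * \<i>) * integral (cbox 0 1) (I x))"
    by (intro continuous_intros integral_continuous_on_param)
  moreover have "1 / (2 * of_real pi * \<i>) * integral (cbox 0 1) (I x) = deriv (\<lambda>u. g u (snd x)) (fst x)"
    if "x \<in> ball u0 \<rho> \<times> Y" for x
  proof -
    have h: "(\<lambda>u. g u (snd x)) holomorphic_on S" using hol that by auto
    have "((\<lambda>u. g u (snd x)) has_field_derivative 1 / (2 * of_real pi * \<i>) *
        contour_integral ?\<gamma> (\<lambda>w. g w (snd x) / (w - fst x)^2)) (at (fst x))"
    proof (rule Cauchy_derivative_integral_circlepath(2))
      show "continuous_on (cball u0 \<rho>) (\<lambda>u. g u (snd x))"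
        using h \<rho> by (meson continuous_on_subset holomorphic_on_imp_continuous_on)
      show "(\<lambda>u. g u (snd x)) holomorphic_on ball u0 \<rho>"
        using h \<rho> by (meson ball_subset_cball holomorphic_on_subset)
    qed (use that in auto)
    then show ?thesis
      unfolding circlepath_integral_01 I_def by (simp add: DERIV_imp_deriv)
  qed
  ultimately have "continuous_on (ball u0 \<rho> \<times> Y) (\<lambda>x. deriv (\<lambda>u. g u (snd x)) (fst x))"
    by (simp cong: continuous_on_cong)
  then have "continuous (at x0 within ball u0 \<rho> \<times> Y) (\<lambda>x. deriv (\<lambda>u. g u (snd x)) (fst x))"
    using \<rho> x0 by (simp add: continuous_on_eq_continuous_within)
  moreover have "at x0 within ball u0 \<rho> \<times> Y = at x0 within S \<times> Y"
  proof (rule at_within_nhd[where S = "ball u0 \<rho> \<times> UNIV"])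
    show "ball u0 \<rho> \<times> Y \<inter> ball u0 \<rho> \<times> UNIV - {x0} = S \<times> Y \<inter> ball u0 \<rho> \<times> UNIV - {x0}"
      using \<rho> by (auto simp: subset_iff)
  qed (use x0 \<rho> in \<open>auto intro: open_Times\<close>)
  ultimately show "continuous (at x0 within S \<times> Y) (\<lambda>x. deriv (\<lambda>u. g u (snd x)) (fst x))"
    by simp
qed

text \<open>Differentiation under the integral sign; the joint continuity of the derivative that it
  requires comes from \<open>continuous_on_deriv_param\<close>. The argument is local because the
  Leibniz rule asks for a convex domain, hence the balls.\<close>

lemma holomorphic_on_param_integral:
  fixes g :: "complex \<Rightarrow> 'b::euclidean_space \<Rightarrow> complex"
  assumes S: "open S" and cont: "continuous_on (S \<times> cbox a b) (\<lambda>x. g (fst x) (snd x))"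
    and hol: "\<And>y. y \<in> cbox a b \<Longrightarrow> (\<lambda>u. g u y) holomorphic_on S"
  shows "(\<lambda>u. integral (cbox a b) (g u)) holomorphic_on S"
proof -
  have "(\<lambda>u. integral (cbox a b) (g u)) field_differentiable at u0" if u0: "u0 \<in> S" for u0
  proof -
    obtain \<rho> where \<rho>: "\<rho> > 0" "ball u0 \<rho> \<subseteq> S" using S u0 open_contains_ball by blast
    have "(\<lambda>u. integral (cbox a b) (g u)) holomorphic_on ball u0 \<rho>"
    proof (rule leibniz_rule_holomorphic[where fx = "\<lambda>u y. deriv (\<lambda>u. g u y) u"])
      show "((\<lambda>x. g x y) has_field_derivative deriv (\<lambda>u. g u y) u) (at u within ball u0 \<rho>)"
        if "u \<in> ball u0 \<rho>" "y \<in> cbox a b" for u y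
        using that hol[of y] \<rho> S by (meson has_field_derivative_at_within holomorphic_derivI subsetD)
      show "g u integrable_on cbox a b" if "u \<in> ball u0 \<rho>" for u
        by (rule integrable_continuous, rule continuous_on_compose2[OF cont, where f = "\<lambda>y. (u, y)", simplified])
          (use that \<rho> in \<open>auto intro!: continuous_intros\<close>)
      show "continuous_on (ball u0 \<rho> \<times> cbox a b) (\<lambda>(u, y). deriv (\<lambda>u. g u y) u)"
        using continuous_on_deriv_param[OF S cont hol] \<rho>
        by (auto simp: split_beta elim!: continuous_on_subset)
    qed auto
    then show ?thesis using \<rho> by (simp add: holomorphic_on_open field_differentiable_def)
  qed
  then show ?thesis by (simp add: S holomorphic_on_def field_differentiable_at_within)
qed

section \<open>Frechet holomorphy versus separate holomorphy\<close>

lemma holomorphic2_atI: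
  assumes "((\<lambda>w. f (fst w) (snd w)) has_derivative (\<lambda>h. a * fst h + b * snd h)) (at (u, v))"
  shows "holomorphic2_at f u v"
  using assms unfolding holomorphic2_at_def by blast

lemma has_derivative2_imp_partials:
  fixes a b :: complex
  assumes "((\<lambda>w. f (fst w) (snd w)) has_derivative (\<lambda>h. a * fst h + b * snd h)) (at (u, v))"
  shows "((\<lambda>s. f s v) has_field_derivative a) (at u)" "((\<lambda>s. f u s) has_field_derivative b) (at v)"
proof -
  have "((\<lambda>s. f (fst (s, v)) (snd (s, v))) has_derivative (\<lambda>h. a * fst (h, 0::complex) + b * snd (h, 0::complex))) (at u)"
    by (rule has_derivative_compose[where f = "\<lambda>s. (s, v)" and g = "\<lambda>w. f (fst w) (snd w)"])
      (auto intro!: derivative_eq_intros assms)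
  then show "((\<lambda>s. f s v) has_field_derivative a) (at u)" by (simp add: has_field_derivative_def)
  have "((\<lambda>s. f (fst (u, s)) (snd (u, s))) has_derivative (\<lambda>h. a * fst (0::complex, h) + b * snd (0::complex, h))) (at v)"
    by (rule has_derivative_compose[where f = "\<lambda>s. (u, s)" and g = "\<lambda>w. f (fst w) (snd w)"])
      (auto intro!: derivative_eq_intros assms)
  then show "((\<lambda>s. f u s) has_field_derivative b) (at v)" by (simp add: has_field_derivative_def)
qed

lemma holomorphic2_at_has_derivative:
  assumes "holomorphic2_at f u v"
  shows "((\<lambda>w. f (fst w) (snd w)) has_derivative
           (\<lambda>h. deriv (\<lambda>s. f s v) u * fst h + deriv (\<lambda>s. f u s) v * snd h)) (at (u, v))"
proof -
  obtain a b where ab: "((\<lambda>w. f (fst w) (snd w)) has_derivative (\<lambda>h. a * fst h + b * snd h)) (at (u, v))"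
    using assms unfolding holomorphic2_at_def by blast
  show ?thesis using ab has_derivative2_imp_partials[OF ab] by (simp add: DERIV_imp_deriv)
qed

lemma holomorphic2_at_partials:
  assumes "holomorphic2_at f u v"
  shows "((\<lambda>s. f s v) has_field_derivative deriv (\<lambda>s. f s v) u) (at u)"
    and "((\<lambda>s. f u s) has_field_derivative deriv (\<lambda>s. f u s) v) (at v)"
  using has_derivative2_imp_partials[OF holomorphic2_at_has_derivative[OF assms]] by simp_all

lemma holomorphic2_at_isCont:
  "holomorphic2_at f u v \<Longrightarrow> isCont (\<lambda>w. f (fst w) (snd w)) (u, v)"
  using has_derivative_continuous holomorphic2_at_has_derivative by blast

text \<open>The nontrivial direction is Osgood's lemma: Cauchy's formula makes the partial
  derivative in v jointly continuous, and a Frechet derivative exists as soon as one partial exists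
  at the point and the other is continuous there.\<close>

lemma holomorphic2_on_iff_separately:
  assumes U: "open U"
  shows "holomorphic2_on f U \<longleftrightarrow>
    continuous_on U (\<lambda>w. f (fst w) (snd w)) \<and>
    (\<forall>v. (\<lambda>u. f u v) holomorphic_on {u. (u, v) \<in> U}) \<and>
    (\<forall>u. (\<lambda>v. f u v) holomorphic_on {v. (u, v) \<in> U})" (is "?L \<longleftrightarrow> ?R")
proof
  assume L: ?L
  then have at: "holomorphic2_at f u v" if "(u, v) \<in> U" for u v
    using that unfolding holomorphic2_on_def by blast
  have "continuous_on U (\<lambda>w. f (fst w) (snd w))"
    using at holomorphic2_at_isCont by (force intro!: continuous_at_imp_continuous_on)
  moreover have "(\<lambda>s. f s v) field_differentiable at u" "f u field_differentiable at v"
    if "(u, v) \<in> U" for u v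
    using holomorphic2_at_partials[OF at[OF that]] by (auto simp: field_differentiable_def)
  ultimately show ?R
    unfolding holomorphic_on_def by (auto intro: field_differentiable_at_within)
next
  assume R: ?R
  show ?L unfolding holomorphic2_on_def
  proof clarify
    fix u0 v0 assume "(u0, v0) \<in> U"
    then obtain A B where AB: "open A" "open B" "(u0, v0) \<in> A \<times> B" "A \<times> B \<subseteq> U"
      using U open_prod_elim by blast
    then obtain \<rho> where \<rho>: "\<rho> > 0" "ball v0 \<rho> \<subseteq> B"
      by (meson SigmaD2 open_contains_ball)
    let ?B = "ball v0 \<rho>"
    have sub: "A \<times> ?B \<subseteq> U" using AB \<rho> by auto
    have holv: "(\<lambda>v. f u v) holomorphic_on ?B" if "u \<in> A" for u
      by (rule holomorphic_on_subset[of _ "{v. (u, v) \<in> U}"]) (use R sub that in auto)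
    \<comment> \<open>The variables are exchanged here and back again below, since
      \<open>continuous_on_deriv_param\<close> differentiates in the first argument.\<close>
    have "continuous_on (?B \<times> A) (\<lambda>x. f (snd x) (fst x))"
      by (rule continuous_on_compose2[OF conjunct1[OF R], where f = "\<lambda>x. (snd x, fst x)", simplified])
        (use sub in \<open>auto intro!: continuous_intros\<close>)
    from continuous_on_deriv_param[OF _ this holv]
    have "continuous_on (?B \<times> A) (\<lambda>x. deriv (\<lambda>v. f (snd x) v) (fst x))" by auto
    from continuous_on_compose2[OF this, of "A \<times> ?B" "\<lambda>x. (snd x, fst x)",
        OF continuous_on_Pair[OF continuous_on_snd[OF continuous_on_id] continuous_on_fst[OF continuous_on_id]]]
    have c: "continuous_on (A \<times> ?B) (\<lambda>x. deriv (\<lambda>v. f (fst x) v) (snd x))"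
      by force
    have holu: "(\<lambda>u. f u v0) holomorphic_on A"
      by (rule holomorphic_on_subset[of _ "{u. (u, v0) \<in> U}"]) (use R AB in auto)
    then obtain a where a: "((\<lambda>u. f u v0) has_field_derivative a) (at u0)"
      using AB by (auto simp: holomorphic_on_open)
    let ?d = "\<lambda>u v. deriv (\<lambda>v. f u v) v"
    \<comment> \<open>The roles are asymmetric: in u only the derivative at \<open>u0\<close> along
      \<open>v0\<close> is used, in v the derivative throughout the product together with its
      continuity. The partial in v takes values in bounded linear maps, whence
      \<open>blinfun_mult_right\<close>.\<close>
    have "((\<lambda>(x, y). f x y) has_derivative (\<lambda>(tx, ty). a * tx + blinfun_mult_right (?d u0 v0) ty)) (at (u0, v0) within A \<times> ?B)"
    proof (rule has_derivative_partialsI[where fy = "\<lambda>u v. blinfun_mult_right (?d u v)"])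
      show "((\<lambda>x. f x v0) has_derivative (*) a) (at u0 within A)"
        using a by (simp add: has_field_derivative_def has_derivative_at_withinI)
      show "((\<lambda>v. f u v) has_derivative blinfun_apply (blinfun_mult_right (?d u v))) (at v within ?B)"
        if "u \<in> A" "v \<in> ?B" for u v
        using holomorphic_derivI[OF holv[OF that(1)] _ that(2)]
        by (simp add: has_field_derivative_eq_has_derivative_blinfun has_derivative_at_withinI)
      have "continuous_on (A \<times> ?B) (\<lambda>x. blinfun_mult_right (?d (fst x) (snd x)))"
        by (intro continuous_intros c)
      then show "continuous (at (u0, v0) within A \<times> ?B) (\<lambda>(u, v). blinfun_mult_right (?d u v))"
        unfolding continuous_on_eq_continuous_within case_prod_unfold
        by (rule bspec) (use AB \<rho> in auto)
    qed (use \<rho> in auto)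
    moreover have "at (u0, v0) within A \<times> ?B = at (u0, v0)"
      using AB \<rho> by (intro at_within_open) (auto intro: open_Times)
    ultimately show "holomorphic2_at f u0 v0"
      by (intro holomorphic2_atI[of _ a "?d u0 v0"]) (simp add: case_prod_unfold)
  qed
qed

lemma holomorphic2_on_Times_iff:
  assumes "open A" "open B"
  shows "holomorphic2_on f (A \<times> B) \<longleftrightarrow>
    continuous_on (A \<times> B) (\<lambda>w. f (fst w) (snd w)) \<and>
    (\<forall>v\<in>B. (\<lambda>u. f u v) holomorphic_on A) \<and> (\<forall>u\<in>A. (\<lambda>v. f u v) holomorphic_on B)"
proof -
  have eq: "{u. (u, v) \<in> A \<times> B} = (if v \<in> B then A else {})"
    "{v. (u, v) \<in> A \<times> B} = (if u \<in> A then B else {})" for u v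
    by auto
  have "(\<lambda>u. f u v) holomorphic_on (if v \<in> B then A else {}) \<longleftrightarrow> v \<in> B \<longrightarrow> (\<lambda>u. f u v) holomorphic_on A"
    "(\<lambda>v. f u v) holomorphic_on (if u \<in> A then B else {}) \<longleftrightarrow> u \<in> A \<longrightarrow> (\<lambda>v. f u v) holomorphic_on B" for u v
    by (simp_all add: holomorphic_on_empty)
  then show ?thesis
    unfolding holomorphic2_on_iff_separately[OF open_Times[OF assms]] eq Ball_def by (simp only:)
qed

lemma open_slices:
  assumes "open (U :: ('a::topological_space \<times> 'b::topological_space) set)"
  shows "open {u. (u, v) \<in> U}" "open {v. (u, v) \<in> U}"
proof -
  have "open ((\<lambda>u. (u, v)) -` U)" "open ((\<lambda>v. (u, v)) -` U)"
    by (rule open_vimage[OF assms]; intro continuous_intros)+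
  then show "open {u. (u, v) \<in> U}" "open {v. (u, v) \<in> U}" by (simp_all add: vimage_def)
qed

lemma holomorphic2_on_subset: "holomorphic2_on f U \<Longrightarrow> V \<subseteq> U \<Longrightarrow> holomorphic2_on f V"
  unfolding holomorphic2_on_def by blast

text \<open>Carries results about the first variable over to the second.\<close>

lemma holomorphic2_on_swap:
  assumes "open U" "holomorphic2_on f U"
  shows "holomorphic2_on (\<lambda>v u. f u v) (prod.swap ` U)"
proof -
  have U: "prod.swap ` U = {(v, u). (u, v) \<in> U}" and V: "prod.swap ` U = prod.swap -` U"
    by force+
  have "open (prod.swap -` U)"
    unfolding prod.swap_def by (intro open_vimage[OF assms(1)] continuous_intros)
  then have o: "open (prod.swap ` U)" unfolding V .
  note iff = holomorphic2_on_iff_separately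
  have R: "continuous_on U (\<lambda>w. f (fst w) (snd w))"
    "\<And>v. (\<lambda>u. f u v) holomorphic_on {u. (u, v) \<in> U}" "\<And>u. f u holomorphic_on {v. (u, v) \<in> U}"
    using assms iff by auto
  have "continuous_on (prod.swap ` U) (\<lambda>w. f (snd w) (fst w))"
    using continuous_on_compose2[OF R(1), of "prod.swap ` U" "\<lambda>x. (snd x, fst x)",
        OF continuous_on_Pair[OF continuous_on_snd[OF continuous_on_id] continuous_on_fst[OF continuous_on_id]]]
    by force
  with R show ?thesis
    unfolding iff[OF o] by (simp add: U)
qed

text \<open>By separate holomorphy this splits into continuity of a parameter integral and the
  one-variable statement on each slice.\<close>

lemma holomorphic2_on_param_integral:
  assumes U: "open U"
    and cont: "continuous_on (U \<times> cbox a b) (\<lambda>x. k (fst (fst x)) (snd (fst x)) (snd x))"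
    and hol: "\<And>\<theta>. \<theta> \<in> cbox a b \<Longrightarrow> holomorphic2_on (\<lambda>u v. k u v \<theta>) U"
  shows "holomorphic2_on (\<lambda>u v. integral (cbox a b) (k u v :: real \<Rightarrow> complex)) U"
  unfolding holomorphic2_on_iff_separately[OF U]
proof (intro conjI allI)
  show "continuous_on U (\<lambda>w. integral (cbox a b) (k (fst w) (snd w)))"
    using cont by (intro integral_continuous_on_param) (simp add: split_beta)
  show "(\<lambda>u. integral (cbox a b) (k u v)) holomorphic_on {u. (u, v) \<in> U}" for v
  proof (rule holomorphic_on_param_integral)
    show "continuous_on ({u. (u, v) \<in> U} \<times> cbox a b) (\<lambda>x. k (fst x) v (snd x))"
      by (rule continuous_on_compose2[OF cont, where f = "\<lambda>x. ((fst x, v), snd x)", simplified])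
        (auto intro!: continuous_intros)
    show "(\<lambda>u. k u v \<theta>) holomorphic_on {u. (u, v) \<in> U}" if "\<theta> \<in> cbox a b" for \<theta>
      using hol[OF that] U by (simp add: holomorphic2_on_iff_separately)
  qed (simp add: open_slices U)
  show "(\<lambda>v. integral (cbox a b) (k u v)) holomorphic_on {v. (u, v) \<in> U}" for u
  proof (rule holomorphic_on_param_integral)
    show "continuous_on ({v. (u, v) \<in> U} \<times> cbox a b) (\<lambda>x. k u (fst x) (snd x))"
      by (rule continuous_on_compose2[OF cont, where f = "\<lambda>x. ((u, fst x), snd x)", simplified])
        (auto intro!: continuous_intros)
    show "(\<lambda>v. k u v \<theta>) holomorphic_on {v. (u, v) \<in> U}" if "\<theta> \<in> cbox a b" for \<theta>
      using hol[OF that] U by (simp add: holomorphic2_on_iff_separately)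
  qed (simp add: open_slices U)
qed


text \<open>Only the dependence on v needs an argument: for fixed u the derivative is a Cauchy
  integral over a circle around u that does not move with v, and its integrand is holomorphic in v.
  Products of open sets suffice since the claim is local.\<close>

lemma holomorphic2_on_deriv_fst:
  assumes U: "open U" and f: "holomorphic2_on f U"
  shows "holomorphic2_on (\<lambda>u v. deriv (\<lambda>s. f s v) u) U"
  unfolding holomorphic2_on_def
proof clarify
  fix u0 v0 assume "(u0, v0) \<in> U"
  then obtain A B where AB: "open A" "open B" "(u0, v0) \<in> A \<times> B" "A \<times> B \<subseteq> U"
    using U open_prod_elim by blast
  note iff = holomorphic2_on_Times_iff[OF AB(1,2)]
  have cont: "continuous_on (A \<times> B) (\<lambda>w. f (fst w) (snd w))"
    and hu: "\<And>v. v \<in> B \<Longrightarrow> (\<lambda>u. f u v) holomorphic_on A"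
    and hv: "\<And>u. u \<in> A \<Longrightarrow> (\<lambda>v. f u v) holomorphic_on B"
    using holomorphic2_on_subset[OF f AB(4)] iff by blast+
  have "(\<lambda>v. deriv (\<lambda>s. f s v) u) holomorphic_on B" if u: "u \<in> A" for u
  proof -
    obtain \<rho> where \<rho>: "\<rho> > 0" "cball u \<rho> \<subseteq> A" using AB u open_contains_cball by blast
    let ?\<gamma> = "circlepath u \<rho>"
    have mem: "?\<gamma> \<theta> \<in> A" "?\<gamma> \<theta> \<noteq> u" for \<theta>
    proof -
      have n: "norm (?\<gamma> \<theta> - u) = \<rho>" using \<rho> circlepath_norm by simp
      then have "dist u (?\<gamma> \<theta>) = \<rho>" by (simp add: dist_norm norm_minus_commute)
      then show "?\<gamma> \<theta> \<in> A" "?\<gamma> \<theta> \<noteq> u" using \<rho> by (auto simp: subset_iff)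
    qed
    define I where "I v \<theta> = f (?\<gamma> \<theta>) v / (?\<gamma> \<theta> - u)^2 * (2 * of_real pi * \<i> * (?\<gamma> \<theta> - u))" for v \<theta>
    have "continuous_on (B \<times> cbox (0::real) 1) (\<lambda>z. f (?\<gamma> (snd z)) (fst z))"
      by (rule continuous_on_compose2[OF cont, where f = "\<lambda>z. (?\<gamma> (snd z), fst z)", simplified])
        (use mem in \<open>auto intro!: continuous_intros\<close>)
    then have "continuous_on (B \<times> cbox (0::real) 1) (\<lambda>z. I (fst z) (snd z))"
      unfolding I_def by (intro continuous_intros) (use mem in auto)
    moreover have "(\<lambda>v. I v \<theta>) holomorphic_on B" for \<theta>
      unfolding I_def by (intro holomorphic_intros hv) (use mem in auto)
    ultimately have "(\<lambda>v. 1 / (2 * of_real pi * \<i>) * integral (cbox 0 1) (I v)) holomorphic_on B"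
      using AB by (intro holomorphic_on_param_integral holomorphic_intros)
    moreover have "1 / (2 * of_real pi * \<i>) * integral (cbox 0 1) (I v) = deriv (\<lambda>s. f s v) u"
      if "v \<in> B" for v
    proof -
      have h: "(\<lambda>u. f u v) holomorphic_on A" using hu that by auto
      have "((\<lambda>u. f u v) has_field_derivative 1 / (2 * of_real pi * \<i>) *
          contour_integral ?\<gamma> (\<lambda>w. f w v / (w - u)^2)) (at u)"
      proof (rule Cauchy_derivative_integral_circlepath(2))
        show "continuous_on (cball u \<rho>) (\<lambda>u. f u v)"
          using h \<rho> by (meson continuous_on_subset holomorphic_on_imp_continuous_on)
        show "(\<lambda>u. f u v) holomorphic_on ball u \<rho>"
          using h \<rho> by (meson ball_subset_cball holomorphic_on_subset)
      qed (use \<rho> in auto)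
      then show ?thesis
        unfolding circlepath_integral_01 I_def by (simp add: DERIV_imp_deriv)
    qed
    ultimately show ?thesis by (simp cong: holomorphic_cong)
  qed
  moreover have "(\<lambda>u. deriv (\<lambda>s. f s v) u) holomorphic_on A" if "v \<in> B" for v
    using hu[OF that] AB by (intro holomorphic_deriv)
  moreover have "continuous_on (A \<times> B) (\<lambda>w. deriv (\<lambda>s. f s (snd w)) (fst w))"
    using continuous_on_deriv_param[OF AB(1) cont hu] by simp
  ultimately have "holomorphic2_on (\<lambda>u v. deriv (\<lambda>s. f s v) u) (A \<times> B)"
    unfolding iff by blast
  then show "holomorphic2_at (\<lambda>u v. deriv (\<lambda>s. f s v) u) u0 v0"
    using AB unfolding holomorphic2_on_def by blast
qed

lemma holomorphic2_on_deriv_snd: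
  assumes U: "open U" and f: "holomorphic2_on f U"
  shows "holomorphic2_on (\<lambda>u v. deriv (\<lambda>s. f u s) v) U"
proof -
  have "prod.swap ` U = prod.swap -` U" by force
  moreover have "open (prod.swap -` U)"
    unfolding prod.swap_def by (intro open_vimage[OF U] continuous_intros)
  ultimately have o: "open (prod.swap ` U)" by simp
  have "holomorphic2_on (\<lambda>v u. deriv (\<lambda>s. f u s) v) (prod.swap ` U)"
    using holomorphic2_on_deriv_fst[OF o, where f = "\<lambda>v u. f u v"] holomorphic2_on_swap[OF U f] by simp
  then have "holomorphic2_on (\<lambda>u v. deriv (\<lambda>s. f u s) v) (prod.swap ` prod.swap ` U)"
    using holomorphic2_on_swap[OF o, where f = "\<lambda>v u. deriv (\<lambda>s. f u s) v"] by simp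
  then show ?thesis by (simp add: image_image)
qed

section \<open>Algebraic operations and brackets\<close>

lemma
  assumes U: "open U" and f: "holomorphic2_on f U" and g: "holomorphic2_on g U"
  shows holomorphic2_on_add: "holomorphic2_on (\<lambda>u v. f u v + g u v) U"
    and holomorphic2_on_diff: "holomorphic2_on (\<lambda>u v. f u v - g u v) U"
    and holomorphic2_on_mult: "holomorphic2_on (\<lambda>u v. f u v * g u v) U"
    and holomorphic2_on_divide:
      "(\<And>u v. (u, v) \<in> U \<Longrightarrow> g u v \<noteq> 0) \<Longrightarrow> holomorphic2_on (\<lambda>u v. f u v / g u v) U"
proof -
  note iff = holomorphic2_on_iff_separately[OF U]
  have R: "continuous_on U (\<lambda>w. f (fst w) (snd w))" "continuous_on U (\<lambda>w. g (fst w) (snd w))"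
    "\<And>v. (\<lambda>u. f u v) holomorphic_on {u. (u, v) \<in> U}" "\<And>u. (\<lambda>v. f u v) holomorphic_on {v. (u, v) \<in> U}"
    "\<And>v. (\<lambda>u. g u v) holomorphic_on {u. (u, v) \<in> U}" "\<And>u. (\<lambda>v. g u v) holomorphic_on {v. (u, v) \<in> U}"
    using f g unfolding iff by blast+
  show "holomorphic2_on (\<lambda>u v. f u v + g u v) U" "holomorphic2_on (\<lambda>u v. f u v - g u v) U"
    "holomorphic2_on (\<lambda>u v. f u v * g u v) U"
    unfolding iff by (intro conjI allI continuous_intros holomorphic_intros R)+
  show "holomorphic2_on (\<lambda>u v. f u v / g u v) U" if "\<And>u v. (u, v) \<in> U \<Longrightarrow> g u v \<noteq> 0"
    unfolding iff by (intro conjI allI continuous_on_divide holomorphic_on_divide R) (use that in auto)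
qed

lemma holomorphic2_on_const: "holomorphic2_on (\<lambda>u v. c) U"
proof -
  have "holomorphic2_at (\<lambda>u v. c) u v" for u v
    by (rule holomorphic2_atI[of _ 0 0]) simp
  then show ?thesis unfolding holomorphic2_on_def by blast
qed

lemma holomorphic2_on_sum:
  assumes U: "open U" and "\<And>i. i \<in> I \<Longrightarrow> holomorphic2_on (f i) U"
  shows "holomorphic2_on (\<lambda>u v. \<Sum>i\<in>I. f i u v) U"
  using assms(2)
proof (induction I rule: infinite_finite_induct)
  case (insert i I)
  have "holomorphic2_on (\<lambda>u v. f i u v + (\<Sum>i\<in>I. f i u v)) U"
    using insert.IH insert.prems by (intro holomorphic2_on_add[OF U]) blast+
  then show ?case using insert.hyps by simp
next
  case (infinite I)
  have "holomorphic2_on (\<lambda>u v. 0) U" by (rule holomorphic2_on_const)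
  then show ?case unfolding sum.infinite[OF infinite.hyps] .
next
  case empty
  have "holomorphic2_on (\<lambda>u v. 0) U" by (rule holomorphic2_on_const)
  then show ?case unfolding sum.empty .
qed

lemma holomorphic2_on_poisson:
  assumes "open U" "holomorphic2_on f U" "holomorphic2_on g U"
  shows "holomorphic2_on (poisson f g) U"
proof -
  note d = holomorphic2_on_deriv_fst[OF assms(1)] holomorphic2_on_deriv_snd[OF assms(1)]
  have "holomorphic2_on (\<lambda>u v. deriv (\<lambda>s. f s v) u * deriv (\<lambda>s. g u s) v - deriv (\<lambda>s. f u s) v * deriv (\<lambda>s. g s v) u) U"
    by (rule holomorphic2_on_diff[OF assms(1)]; rule holomorphic2_on_mult[OF assms(1)];
        rule d[OF assms(2)] d[OF assms(3)])
  then show ?thesis unfolding poisson_def [abs_def] .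
qed

section \<open>Chain rule and locality\<close>

lemma has_derivative2_compose:
  assumes f: "holomorphic2_at f (g u v) (h u v)"
    and g: "holomorphic2_at g u v" and h: "holomorphic2_at h u v"
  defines "a \<equiv> deriv (\<lambda>s. f s (h u v)) (g u v)" and "b \<equiv> deriv (\<lambda>s. f (g u v) s) (h u v)"
  shows "((\<lambda>w. f (g (fst w) (snd w)) (h (fst w) (snd w))) has_derivative
    (\<lambda>d. (a * deriv (\<lambda>s. g s v) u + b * deriv (\<lambda>s. h s v) u) * fst d
       + (a * deriv (\<lambda>s. g u s) v + b * deriv (\<lambda>s. h u s) v) * snd d)) (at (u, v))"
proof -
  have gh: "((\<lambda>w. (g (fst w) (snd w), h (fst w) (snd w))) has_derivative
     (\<lambda>d. (deriv (\<lambda>s. g s v) u * fst d + deriv (\<lambda>s. g u s) v * snd d,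
           deriv (\<lambda>s. h s v) u * fst d + deriv (\<lambda>s. h u s) v * snd d))) (at (u, v))"
    by (intro has_derivative_Pair holomorphic2_at_has_derivative g h)
  have f': "((\<lambda>w. f (fst w) (snd w)) has_derivative (\<lambda>d. a * fst d + b * snd d)) (at (g u v, h u v))"
    using holomorphic2_at_has_derivative[OF f] unfolding a_def b_def .
  show ?thesis
    by (rule has_derivative_eq_rhs[OF has_derivative_compose[OF gh, of "\<lambda>w. f (fst w) (snd w)", simplified, OF f']])
      (simp add: algebra_simps)
qed

lemma holomorphic2_at_compose:
  "holomorphic2_at f (g u v) (h u v) \<Longrightarrow> holomorphic2_at g u v \<Longrightarrow> holomorphic2_at h u v
    \<Longrightarrow> holomorphic2_at (\<lambda>u v. f (g u v) (h u v)) u v"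
  by (rule holomorphic2_atI, rule has_derivative2_compose)

lemma holomorphic2_at_cong:
  assumes V: "open V" "(u, v) \<in> V" and eq: "\<And>u v. (u, v) \<in> V \<Longrightarrow> f u v = g u v"
  shows "holomorphic2_at f u v \<longleftrightarrow> holomorphic2_at g u v"
proof -
  have "((\<lambda>w. f (fst w) (snd w)) has_derivative D) (at (u, v)) \<longleftrightarrow>
        ((\<lambda>w. g (fst w) (snd w)) has_derivative D) (at (u, v))" for D
    by (rule iffI; erule has_derivative_transform_within_open[OF _ V]) (auto simp: eq)
  then show ?thesis unfolding holomorphic2_at_def by simp
qed

text \<open>The bracket depends only on germs. This allows a function on D to be replaced by an
  expression that represents it near one puncture only.\<close>

lemma poisson_cong:
  assumes V: "open V" "(u, v) \<in> V" and "\<And>u v. (u, v) \<in> V \<Longrightarrow> f u v = f' u v"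
    and "\<And>u v. (u, v) \<in> V \<Longrightarrow> g u v = g' u v"
  shows "poisson f g u v = poisson f' g' u v"
proof -
  have "eventually (\<lambda>s. (s, v) \<in> V) (nhds u)" "eventually (\<lambda>s. (u, s) \<in> V) (nhds v)"
    using open_slices[OF V(1), of v] open_slices[OF V(1), of u] V
    by (auto simp: eventually_nhds)
  then have "deriv (\<lambda>s. f s v) u = deriv (\<lambda>s. f' s v) u" "deriv (\<lambda>s. f u s) v = deriv (\<lambda>s. f' u s) v"
    "deriv (\<lambda>s. g s v) u = deriv (\<lambda>s. g' s v) u" "deriv (\<lambda>s. g u s) v = deriv (\<lambda>s. g' u s) v"
    by (auto intro!: deriv_cong_ev elim!: eventually_mono simp: assms)
  then show ?thesis by (simp add: poisson_def)
qed

section \<open>Laurent series on annuli\<close>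

lemma open_annulus: "open (annulus c r R)"
proof -
  have "annulus c r R = {p. r < norm (p - c)} \<inter> (\<lambda>p. ereal (norm (p - c))) -` {..<R}"
    by (auto simp: annulus_def)
  moreover have "open ((\<lambda>p. ereal (norm (p - c))) -` {..<R})"
    by (rule open_vimage) (auto intro!: continuous_intros)
  moreover have "open {p. r < norm (p - c)}"
    by (intro open_Collect_less continuous_intros)
  ultimately show ?thesis by auto
qed

text \<open>Concentric circles are joined by the radial homotopy, which never leaves the
  annulus.\<close>

lemma circlepath_integral_annulus_cong:
  assumes f: "f holomorphic_on annulus c r R" and r: "0 \<le> r"
    and \<rho>: "r < \<rho>" "ereal \<rho> < R" "r < \<rho>'" "ereal \<rho>' < R"
  shows "contour_integral (circlepath c \<rho>) f = contour_integral (circlepath c \<rho>') f"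
proof (rule Cauchy_theorem_homotopic_loops[OF _ open_annulus f])
  show "homotopic_loops (annulus c r R) (circlepath c \<rho>) (circlepath c \<rho>')"
  proof (rule homotopic_loops_linear)
    fix t show "closed_segment (circlepath c \<rho> t) (circlepath c \<rho>' t) \<subseteq> annulus c r R"
    proof
      fix w assume "w \<in> closed_segment (circlepath c \<rho> t) (circlepath c \<rho>' t)"
      then obtain u where u: "0 \<le> u" "u \<le> 1"
        and w: "w = (1 - u) *\<^sub>R circlepath c \<rho> t + u *\<^sub>R circlepath c \<rho>' t"
        by (auto simp: closed_segment_def)
      \<comment> \<open>Interpolating two points at the same angle gives the point at that angle
        with interpolated radius s, and s lies between the two admissible radii.\<close>
      define s where "s = (1 - u) * \<rho> + u * \<rho>'"
      have s: "s \<in> closed_segment \<rho> \<rho>'"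
        using u unfolding s_def closed_segment_def by auto
      have "r < s" "ereal s < R"
      proof -
        have "min \<rho> \<rho>' \<le> s" "s \<le> max \<rho> \<rho>'"
          using s by (auto simp: closed_segment_eq_real_ivl split: if_splits)
        then show "r < s" using \<rho> by linarith
        have "ereal s \<le> ereal (max \<rho> \<rho>')" using \<open>s \<le> max \<rho> \<rho>'\<close> by (simp only: ereal_less_eq)
        also have "\<dots> < R" using \<rho> by (simp add: max_def)
        finally show "ereal s < R" .
      qed
      moreover have "w = circlepath c s t"
        unfolding w circlepath s_def by (simp add: algebra_simps scaleR_conv_of_real)
      moreover have "norm (circlepath c s t - c) = s"
        using \<open>r < s\<close> r by (intro circlepath_norm) simp
      ultimately show "w \<in> annulus c r R" by (simp add: annulus_def)
    qed
  qed auto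
qed auto

section \<open>Integrals of powers and of geometric series over a circle\<close>

lemma contour_integral_circlepath_powi:
  assumes "\<rho> > 0"
  shows "contour_integral (circlepath c \<rho>) (\<lambda>w. (w - c) powi n) = (if n = -1 then 2 * of_real pi * \<i> else 0)"
proof (cases "n = -1")
  case True
  then show ?thesis
    using contour_integral_circlepath[OF assms, of c] by (simp add: power_int_minus divide_inverse)
next
  case False
  have "((\<lambda>w. (w - c) powi n) has_contour_integral 0) (circlepath c \<rho>)"
  proof (rule Cauchy_theorem_primitive)
    fix w assume w: "w \<in> sphere c \<rho>"
    then have "w \<noteq> c" using assms by auto
    moreover have "of_int (n + 1) \<noteq> (0 :: complex)" using False
      by (metis add_eq_0_iff2 of_int_eq_0_iff)
    ultimately show "((\<lambda>w. (w - c) powi (n + 1) / of_int (n + 1)) has_field_derivative (w - c) powi n) (at w within sphere c \<rho>)"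
      by (auto intro!: derivative_eq_intros)
  qed (use assms in auto)
  then show ?thesis using False by (simp add: contour_integral_unique)
qed

text \<open>Serves both expansions of the Cauchy kernel, with y the ratio of p - c to w - c or its
  inverse. The uniform bound \<theta> < 1 gives convergence by the Weierstrass test; absolute
  summability is recorded as well because \<open>laurent_series_on\<close> uses unordered
  sums.\<close>

lemma contour_integral_geometric_sums:
  assumes g: "continuous_on (sphere c \<rho>) g" and y: "continuous_on (sphere c \<rho>) y"
    and \<rho>: "\<rho> > 0" and \<theta>: "\<theta> < 1" "\<And>w. w \<in> sphere c \<rho> \<Longrightarrow> norm (y w) \<le> \<theta>"
  shows "(\<lambda>n. contour_integral (circlepath c \<rho>) (\<lambda>w. g w * y w ^ n)) sums
           contour_integral (circlepath c \<rho>) (\<lambda>w. g w / (1 - y w))"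
    and "summable (\<lambda>n. norm (contour_integral (circlepath c \<rho>) (\<lambda>w. g w * y w ^ n)))"
proof -
  let ?C = "circlepath c \<rho>"
  have int: "(\<lambda>w. g w * y w ^ n) contour_integrable_on ?C" for n
    using g y \<rho> by (intro contour_integrable_continuous_circlepath continuous_intros) auto
  have "compact (g ` sphere c \<rho>)" using g by (intro compact_continuous_image) auto
  then obtain B where B: "B > 0" "\<And>w. w \<in> sphere c \<rho> \<Longrightarrow> norm (g w) \<le> B"
    using compact_imp_bounded[of "g ` sphere c \<rho>"] by (auto simp: bounded_pos)
  have "c + of_real \<rho> \<in> sphere c \<rho>" using \<rho> by (simp add: dist_norm)
  then have \<theta>0: "0 \<le> \<theta>" using \<theta>(2) norm_ge_zero order_trans by blast
  have bnd: "norm (g w * y w ^ n) \<le> B * \<theta> ^ n" if "w \<in> sphere c \<rho>" for w n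
    unfolding norm_mult norm_power
    using that B \<theta> \<theta>0 by (intro mult_mono power_mono) (auto intro: less_imp_le)
  have sum\<theta>: "summable (\<lambda>n. B * \<theta> ^ n)"
    using \<theta> \<theta>0 by (intro summable_mult summable_geometric) auto
  have "uniform_limit (sphere c \<rho>) (\<lambda>n w. \<Sum>i<n. g w * y w ^ i) (\<lambda>w. \<Sum>i. g w * y w ^ i) sequentially"
    using bnd sum\<theta> by (intro Weierstrass_m_test)
  then have "uniform_limit (sphere c \<rho>) (\<lambda>n w. \<Sum>i<n. g w * y w ^ i) (\<lambda>w. g w / (1 - y w)) sequentially"
  proof (rule uniform_limit_cong'[THEN iffD1, rotated -1])
    fix w assume "w \<in> sphere c \<rho>"
    then have "norm (y w) < 1" using \<theta> by fastforce
    then show "(\<Sum>i. g w * y w ^ i) = g w / (1 - y w)"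
      by (simp add: suminf_mult summable_geometric suminf_geometric)
  qed auto
  then have "((\<lambda>n. contour_integral ?C (\<lambda>w. \<Sum>i<n. g w * y w ^ i)) \<longlonglongrightarrow> contour_integral ?C (\<lambda>w. g w / (1 - y w))) "
    using \<rho> int by (intro contour_integral_uniform_limit_circlepath(2)) (auto intro!: always_eventually contour_integrable_sum)
  then show "(\<lambda>n. contour_integral ?C (\<lambda>w. g w * y w ^ n)) sums contour_integral ?C (\<lambda>w. g w / (1 - y w))"
    unfolding sums_def using int by (simp add: contour_integral_sum)
  have "norm (contour_integral ?C (\<lambda>w. g w * y w ^ n)) \<le> B * \<theta> ^ n * (2 * pi * \<rho>)" for n
    using has_contour_integral_integral[OF int] bnd \<rho> B \<theta>0
    by (intro has_contour_integral_bound_circlepath) (auto simp: dist_norm norm_minus_commute)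
  then show "summable (\<lambda>n. norm (contour_integral ?C (\<lambda>w. g w * y w ^ n)))"
    by (intro summable_comparison_test'[OF summable_mult2[OF sum\<theta>]]) auto
qed

text \<open>The explicit counterpart of the definite description \<open>laurent_coeffs\<close>. The
  radius stays a parameter since the expansion at a point uses two circles, one on each side of
  it.\<close>

definition laurent_coeff :: "(complex \<Rightarrow> complex) \<Rightarrow> complex \<Rightarrow> real \<Rightarrow> int \<Rightarrow> complex" where
  "laurent_coeff f c \<rho> k =
     1 / (2 * of_real pi * \<i>) * contour_integral (circlepath c \<rho>) (\<lambda>w. f w * (w - c) powi (- k - 1))"

text \<open>Multiplying by the power -k-1 of w - c and integrating term by term kills every term
  except j = k. The sum is unordered, so the uniform limit is taken along the finite subsets of the
  integers.\<close>

lemma laurent_series_on_coeff_unique: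
  assumes a: "laurent_series_on f c A a" and sub: "sphere c \<rho> \<subseteq> A" and \<rho>: "\<rho> > 0"
  shows "a k = laurent_coeff f c \<rho> k"
proof -
  let ?C = "circlepath c \<rho>"
  let ?t = "\<lambda>j w. a j * (w - c) powi j * (w - c) powi (- k - 1)"
  have A: "((\<lambda>j. a j * (w - c) powi j) has_sum f w) UNIV" if "w \<in> sphere c \<rho>" for w
    using a sub that unfolding laurent_series_on_def by blast
  \<comment> \<open>Norms of the terms are constant on the circle, so absolute summability at this
    single point is already a majorant for the whole circle.\<close>
  have "(\<lambda>j. a j * (c + of_real \<rho> - c) powi j) summable_on UNIV"
    using A[of "c + of_real \<rho>"] \<rho> by (auto simp: summable_on_def dist_norm)
  then have "(\<lambda>j. norm (a j * (of_real \<rho>) powi j)) summable_on UNIV"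
    using summable_on_iff_abs_summable_on_complex by force
  then have "(\<lambda>j. norm (a j) * \<rho> powi j * \<rho> powi (- k - 1)) summable_on UNIV"
    using \<rho> by (intro summable_on_cmult_left) (simp add: norm_mult norm_power_int)
  then have lim: "uniform_limit (sphere c \<rho>) (\<lambda>X w. \<Sum>j\<in>X. ?t j w) (\<lambda>w. f w * (w - c) powi (- k - 1))
      (finite_subsets_at_top UNIV)"
    by (rule Weierstrass_m_test_general'[rotated -1])
      (auto simp: norm_mult norm_power_int dist_norm norm_minus_commute intro!: has_sum_cmult_left A)
  have int: "?t j contour_integrable_on ?C" for j
    using \<rho> by (intro contour_integrable_continuous_circlepath continuous_intros) auto
  have val: "contour_integral ?C (?t j) = (if j = k then 2 * of_real pi * \<i> * a k else 0)" for j
  proof -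
    have "contour_integral ?C (?t j) = contour_integral ?C (\<lambda>w. a j * (w - c) powi (j - k - 1))"
    proof (rule contour_integral_cong)
      fix w assume "w \<in> path_image ?C"
      then have "w - c \<noteq> 0" using \<rho> by auto
      then show "?t j w = a j * (w - c) powi (j - k - 1)"
        using power_int_add[of "w - c" j "- k - 1"] by (simp add: mult.assoc algebra_simps)
    qed simp
    also have "\<dots> = a j * contour_integral ?C (\<lambda>w. (w - c) powi (j - k - 1))"
      using \<rho> by (intro contour_integral_lmul contour_integrable_continuous_circlepath continuous_intros) auto
    finally show ?thesis using contour_integral_circlepath_powi[OF \<rho>, of c "j - k - 1"] by auto
  qed
  have "((\<lambda>X. contour_integral ?C (\<lambda>w. \<Sum>j\<in>X. ?t j w)) \<longlongrightarrow>
       contour_integral ?C (\<lambda>w. f w * (w - c) powi (- k - 1))) (finite_subsets_at_top UNIV)"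
    using \<rho> int lim
    by (intro contour_integral_uniform_limit_circlepath(2))
      (auto intro!: contour_integrable_sum)
  \<comment> \<open>Once X contains k, the integral of the finite sum no longer changes; hence the
    witness {k}.\<close>
  moreover have "\<forall>\<^sub>F X in finite_subsets_at_top UNIV.
      contour_integral ?C (\<lambda>w. \<Sum>j\<in>X. ?t j w) = 2 * of_real pi * \<i> * a k"
    unfolding eventually_finite_subsets_at_top
    by (rule exI[of _ "{k}"]) (use int in \<open>auto simp: contour_integral_sum val\<close>)
  then have "((\<lambda>X. contour_integral ?C (\<lambda>w. \<Sum>j\<in>X. ?t j w)) \<longlongrightarrow> 2 * of_real pi * \<i> * a k) (finite_subsets_at_top UNIV)"
    by (rule tendsto_eventually)
  ultimately have "contour_integral ?C (\<lambda>w. f w * (w - c) powi (- k - 1)) = 2 * of_real pi * \<i> * a k"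
    by (intro tendsto_unique) auto
  then show ?thesis by (simp add: laurent_coeff_def)
qed

text \<open>The difference quotient of f at p is holomorphic across p, so its integrals over the two
  circles agree. The formula follows because 1/(w - p) integrates to 2 pi i over the circle that
  encloses p and to 0 over the other.\<close>

lemma Cauchy_integral_formula_annulus:
  assumes f: "f holomorphic_on annulus c r R" and r: "0 \<le> r"
    and \<rho>: "r < \<rho>1" "\<rho>1 < norm (p - c)" "norm (p - c) < \<rho>2" "ereal \<rho>2 < R"
  shows "2 * of_real pi * \<i> * f p =
    contour_integral (circlepath c \<rho>2) (\<lambda>w. f w / (w - p)) - contour_integral (circlepath c \<rho>1) (\<lambda>w. f w / (w - p))"
proof -
  have less: "ereal s < R" if "s \<le> \<rho>2" for s
    using that \<rho>(4) by (meson ereal_less_eq(3) le_less_trans)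
  \<comment> \<open>The quotient is written as a difference of two fractions so that its integral
    splits into the two integrals evaluated below.\<close>
  define H where "H w = (if w = p then deriv f p else f w / (w - p) - f p / (w - p))" for w
  have H: "H holomorphic_on annulus c r R"
    unfolding H_def by (rule pole_theorem_open[OF f open_annulus]) simp
  have eq: "contour_integral (circlepath c s) H =
      contour_integral (circlepath c s) (\<lambda>w. f w / (w - p)) - f p * contour_integral (circlepath c s) (\<lambda>w. 1 / (w - p))"
    if s: "r < s" "s \<noteq> norm (p - c)" "s \<le> \<rho>2" for s
  proof -
    have s0: "s > 0" using s r by simp
    have sub: "sphere c s \<subseteq> annulus c r R - {p}"
      using s less[OF s(3)] by (auto simp: annulus_def dist_norm norm_minus_commute)
    have fc: "continuous_on (sphere c s) f"
      using f sub by (meson Diff_subset continuous_on_subset holomorphic_on_imp_continuous_on order_trans)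
    have i1: "(\<lambda>w. f w / (w - p)) contour_integrable_on circlepath c s"
      using s0 sub by (intro contour_integrable_continuous_circlepath continuous_intros) (auto intro: fc)
    have i2: "(\<lambda>w. 1 / (w - p)) contour_integrable_on circlepath c s"
      using s0 sub by (intro contour_integrable_continuous_circlepath continuous_intros) auto
    have "contour_integral (circlepath c s) H = contour_integral (circlepath c s) (\<lambda>w. f w / (w - p) - f p * (1 / (w - p)))"
      by (rule contour_integral_cong) (use s0 sub in \<open>auto simp: H_def\<close>)
    also have "\<dots> = contour_integral (circlepath c s) (\<lambda>w. f w / (w - p)) - contour_integral (circlepath c s) (\<lambda>w. f p * (1 / (w - p)))"
      by (intro contour_integral_diff i1 contour_integrable_lmul i2)
    finally show ?thesis by (simp only: contour_integral_lmul[OF i2])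
  qed
  have "((\<lambda>w. 1 / (w - p)) has_contour_integral 2 * of_real pi * \<i> * 1) (circlepath c \<rho>2)"
    using \<rho> by (intro Cauchy_integral_circlepath) auto
  then have o: "contour_integral (circlepath c \<rho>2) (\<lambda>w. 1 / (w - p)) = 2 * of_real pi * \<i>"
    by (simp add: contour_integral_unique)
  have "((\<lambda>w. 1 / (w - p)) has_contour_integral 0) (circlepath c \<rho>1)"
    by (rule Cauchy_theorem_disc_simple[of _ c "norm (p - c)"])
      (use \<rho> r in \<open>auto intro!: holomorphic_intros simp: dist_norm norm_minus_commute\<close>)
  then have i: "contour_integral (circlepath c \<rho>1) (\<lambda>w. 1 / (w - p)) = 0"
    by (simp add: contour_integral_unique)
  have "contour_integral (circlepath c \<rho>1) H = contour_integral (circlepath c \<rho>2) H"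
    using \<rho> less by (intro circlepath_integral_annulus_cong[OF H r]) auto
  then show ?thesis using eq[of \<rho>1] eq[of \<rho>2] \<rho> o i by (simp add: algebra_simps)
qed

text \<open>Expands 1/(w - p) in powers of (p - c)/(w - c). Since f is only used on the circle, p
  may be anywhere inside it, also outside the annulus where f is defined.\<close>

lemma laurent_coeff_outer_sums:
  assumes f: "continuous_on (sphere c \<rho>) f" and p: "norm (p - c) < \<rho>"
  defines "I \<equiv> 1 / (2 * of_real pi * \<i>) * contour_integral (circlepath c \<rho>) (\<lambda>w. f w / (w - p))"
  shows "(\<lambda>n. laurent_coeff f c \<rho> (int n) * (p - c) ^ n) sums I"
    and "summable (\<lambda>n. norm (laurent_coeff f c \<rho> (int n) * (p - c) ^ n))"
proof -
  have \<rho>: "\<rho> > 0" using p norm_ge_zero le_less_trans by blast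
  have nz: "w - c \<noteq> 0" "w - p \<noteq> 0" if "w \<in> sphere c \<rho>" for w
    using that p \<rho> by (auto simp: dist_norm norm_minus_commute)
  let ?C = "circlepath c \<rho>" and ?g = "\<lambda>w. f w / (w - c)" and ?y = "\<lambda>w. (p - c) / (w - c)"
  have c: "continuous_on (sphere c \<rho>) ?g" "continuous_on (sphere c \<rho>) ?y"
    using nz by (auto intro!: continuous_intros f)
  have \<theta>: "norm (p - c) / \<rho> < 1" "\<And>w. w \<in> sphere c \<rho> \<Longrightarrow> norm (?y w) \<le> norm (p - c) / \<rho>"
    using p \<rho> by (auto simp: norm_divide dist_norm norm_minus_commute)
  have "contour_integral ?C (\<lambda>w. ?g w * ?y w ^ n) =
      contour_integral ?C (\<lambda>w. f w * (w - c) powi (- int n - 1) * (p - c) ^ n)" for n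
  proof (rule contour_integral_cong)
    fix w assume "w \<in> path_image ?C"
    then have "w - c \<noteq> 0" using nz \<rho> by auto
    moreover have "(w - c) powi (- int n - 1) = 1 / ((w - c) ^ n * (w - c))"
    proof -
      have "- int n - 1 = - int (Suc n)" by simp
      then have "(w - c) powi (- int n - 1) = inverse ((w - c) ^ Suc n)"
        by (simp only: power_int_minus power_int_of_nat)
      then show ?thesis by (simp add: divide_inverse mult.commute)
    qed
    ultimately show "?g w * ?y w ^ n = f w * (w - c) powi (- int n - 1) * (p - c) ^ n"
      by (simp add: power_divide)
  qed simp
  also have "contour_integral ?C (\<lambda>w. f w * (w - c) powi (- int n - 1) * (p - c) ^ n) =
      contour_integral ?C (\<lambda>w. f w * (w - c) powi (- int n - 1)) * (p - c) ^ n" for n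
    using \<rho> nz f
    by (intro contour_integral_rmul contour_integrable_continuous_circlepath continuous_intros) auto
  finally have e: "laurent_coeff f c \<rho> (int n) * (p - c) ^ n =
      1 / (2 * of_real pi * \<i>) * contour_integral ?C (\<lambda>w. ?g w * ?y w ^ n)" for n
    by (simp add: laurent_coeff_def)
  have I: "contour_integral ?C (\<lambda>w. ?g w / (1 - ?y w)) = contour_integral ?C (\<lambda>w. f w / (w - p))"
  proof (rule contour_integral_cong)
    fix w assume "w \<in> path_image ?C"
    then have n: "w - c \<noteq> 0" "w - p \<noteq> 0" using nz[of w] \<rho> by auto
    then have "1 - ?y w = (w - p) / (w - c)" by (simp add: divide_simps)
    then show "?g w / (1 - ?y w) = f w / (w - p)" using n by simp
  qed simp
  show "(\<lambda>n. laurent_coeff f c \<rho> (int n) * (p - c) ^ n) sums I"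
    using contour_integral_geometric_sums(1)[OF c \<rho> \<theta>] unfolding e I I_def by (intro sums_mult)
  show "summable (\<lambda>n. norm (laurent_coeff f c \<rho> (int n) * (p - c) ^ n))"
    using contour_integral_geometric_sums(2)[OF c \<rho> \<theta>] unfolding e norm_mult by (intro summable_mult)
qed

text \<open>The same with the reciprocal ratio (w - c)/(p - c), which expands 1/(p - w) and so
  produces the minus sign. The index -(n+1) turns the exponent -k-1 of the coefficient into
  n.\<close>

lemma laurent_coeff_inner_sums:
  assumes f: "continuous_on (sphere c \<rho>) f" and \<rho>: "\<rho> > 0" and p: "\<rho> < norm (p - c)"
  defines "I \<equiv> - (1 / (2 * of_real pi * \<i>) * contour_integral (circlepath c \<rho>) (\<lambda>w. f w / (w - p)))"
  shows "(\<lambda>n. laurent_coeff f c \<rho> (- int (Suc n)) * inverse (p - c) ^ Suc n) sums I"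
    and "summable (\<lambda>n. norm (laurent_coeff f c \<rho> (- int (Suc n)) * inverse (p - c) ^ Suc n))"
proof -
  have nz: "w - p \<noteq> 0" "p - c \<noteq> 0" if "w \<in> sphere c \<rho>" for w
    using that p \<rho> by (auto simp: dist_norm norm_minus_commute)
  let ?C = "circlepath c \<rho>" and ?g = "\<lambda>w. f w / (p - c)" and ?y = "\<lambda>w. (w - c) / (p - c)"
  have c: "continuous_on (sphere c \<rho>) ?g" "continuous_on (sphere c \<rho>) ?y"
    using nz by (auto intro!: continuous_intros f)
  have \<theta>: "\<rho> / norm (p - c) < 1" "\<And>w. w \<in> sphere c \<rho> \<Longrightarrow> norm (?y w) \<le> \<rho> / norm (p - c)"
    using p \<rho> by (simp add: divide_less_eq) (simp add: norm_divide dist_norm norm_minus_commute)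
  have "contour_integral ?C (\<lambda>w. ?g w * ?y w ^ n) =
      contour_integral ?C (\<lambda>w. f w * (w - c) powi (- (- int (Suc n)) - 1) * inverse (p - c) ^ Suc n)" for n
    by (rule contour_integral_cong) (simp_all add: field_simps)
  also have "contour_integral ?C (\<lambda>w. f w * (w - c) powi (- (- int (Suc n)) - 1) * inverse (p - c) ^ Suc n) =
      contour_integral ?C (\<lambda>w. f w * (w - c) powi (- (- int (Suc n)) - 1)) * inverse (p - c) ^ Suc n" for n
    using \<rho> f
    by (intro contour_integral_rmul contour_integrable_continuous_circlepath continuous_intros) auto
  finally have e: "laurent_coeff f c \<rho> (- int (Suc n)) * inverse (p - c) ^ Suc n =
      1 / (2 * of_real pi * \<i>) * contour_integral ?C (\<lambda>w. ?g w * ?y w ^ n)" for n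
    by (simp only: laurent_coeff_def mult.assoc)
  have "contour_integral ?C (\<lambda>w. ?g w / (1 - ?y w)) = contour_integral ?C (\<lambda>w. - (f w / (w - p)))"
  proof (rule contour_integral_cong)
    fix w assume "w \<in> path_image ?C"
    then have "w - p \<noteq> 0" "p - c \<noteq> 0" "p - w \<noteq> 0" using nz[of w] \<rho> by auto
    then show "?g w / (1 - ?y w) = - (f w / (w - p))" by (simp add: divide_simps) (simp add: algebra_simps)
  qed simp
  then have I: "contour_integral ?C (\<lambda>w. ?g w / (1 - ?y w)) = - contour_integral ?C (\<lambda>w. f w / (w - p))"
    by (simp add: contour_integral_neg)
  show "(\<lambda>n. laurent_coeff f c \<rho> (- int (Suc n)) * inverse (p - c) ^ Suc n) sums I"
    using sums_mult[OF contour_integral_geometric_sums(1)[OF c \<rho> \<theta>], of "1 / (2 * of_real pi * \<i>)"]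
    unfolding e I I_def by simp
  show "summable (\<lambda>n. norm (laurent_coeff f c \<rho> (- int (Suc n)) * inverse (p - c) ^ Suc n))"
    using contour_integral_geometric_sums(2)[OF c \<rho> \<theta>] unfolding e norm_mult[of "1 / _"] by (intro summable_mult)
qed

lemma sphere_subset_annulus:
  "r < \<rho> \<Longrightarrow> ereal \<rho> < R \<Longrightarrow> sphere c \<rho> \<subseteq> annulus c r R"
  by (auto simp: annulus_def dist_norm norm_minus_commute)

text \<open>Two circles separate p from the two boundaries: the outer one yields the powers k \<ge>
  0, the inner one the negative powers, and the annular Cauchy formula adds them up. Coefficients do
  not depend on the radius, so both halves can be written with the given \<rho>.\<close>

lemma laurent_series_on_annulus:
  assumes f: "f holomorphic_on annulus c r R" and r: "0 \<le> r" and \<rho>: "r < \<rho>" "ereal \<rho> < R"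
  shows "laurent_series_on f c (annulus c r R) (laurent_coeff f c \<rho>)"
  unfolding laurent_series_on_def
proof
  fix p assume p: "p \<in> annulus c r R"
  let ?n = "norm (p - c)" and ?t = "\<lambda>k. laurent_coeff f c \<rho> k * (p - c) powi k"
  have pc: "p - c \<noteq> 0" using p r by (auto simp: annulus_def)
  obtain \<rho>1 where \<rho>1: "r < \<rho>1" "\<rho>1 < ?n" using p dense[of r ?n] by (auto simp: annulus_def)
  obtain \<rho>2 where \<rho>2: "?n < \<rho>2" "ereal \<rho>2 < R" using p ereal_dense2[of "ereal ?n" R] by (auto simp: annulus_def)
  have "ereal \<rho>1 < ereal ?n" using \<rho>1 by simp
  also have "\<dots> < R" using p by (simp add: annulus_def)
  finally have R1: "ereal \<rho>1 < R" .
  have cont: "continuous_on (sphere c s) f" if "r < s" "ereal s < R" for s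
    using f sphere_subset_annulus[OF that] by (meson continuous_on_subset holomorphic_on_imp_continuous_on)
  have coeff: "laurent_coeff f c s k = laurent_coeff f c \<rho> k" if "r < s" "ereal s < R" for s k
  proof -
    have "(\<lambda>w. f w * (w - c) powi (- k - 1)) holomorphic_on annulus c r R"
      using r by (intro holomorphic_intros f) (auto simp: annulus_def)
    from circlepath_integral_annulus_cong[OF this r that \<rho>] show ?thesis
      by (simp add: laurent_coeff_def)
  qed
  have "((\<lambda>n. laurent_coeff f c \<rho>2 (int n) * (p - c) ^ n) has_sum
      1 / (2 * of_real pi * \<i>) * contour_integral (circlepath c \<rho>2) (\<lambda>w. f w / (w - p))) UNIV"
    using \<rho>1 \<rho>2 by (intro norm_summable_imp_has_sum laurent_coeff_outer_sums cont) auto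
  moreover have "(\<lambda>n. laurent_coeff f c \<rho>2 (int n) * (p - c) ^ n) = ?t \<circ> int"
    using coeff[of \<rho>2] \<rho>1 \<rho>2 by auto
  ultimately have nonneg: "(?t has_sum 1 / (2 * of_real pi * \<i>) * contour_integral (circlepath c \<rho>2) (\<lambda>w. f w / (w - p))) (range int)"
    by (subst has_sum_reindex) auto
  have "((\<lambda>n. laurent_coeff f c \<rho>1 (- int (Suc n)) * inverse (p - c) ^ Suc n) has_sum
      - (1 / (2 * of_real pi * \<i>) * contour_integral (circlepath c \<rho>1) (\<lambda>w. f w / (w - p)))) UNIV"
    using \<rho>1 R1 r by (intro norm_summable_imp_has_sum laurent_coeff_inner_sums cont) auto
  moreover have "(\<lambda>n. laurent_coeff f c \<rho>1 (- int (Suc n)) * inverse (p - c) ^ Suc n) = ?t \<circ> (\<lambda>n. - int (Suc n))"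
    unfolding comp_def coeff[OF \<rho>1(1) R1] power_int_minus power_int_of_nat power_inverse ..
  ultimately have neg: "(?t has_sum - (1 / (2 * of_real pi * \<i>) * contour_integral (circlepath c \<rho>1) (\<lambda>w. f w / (w - p))))
      (range (\<lambda>n. - int (Suc n)))"
    by (subst has_sum_reindex) (auto simp: inj_on_def)
  have "(?t has_sum 1 / (2 * of_real pi * \<i>) * contour_integral (circlepath c \<rho>2) (\<lambda>w. f w / (w - p)) +
      - (1 / (2 * of_real pi * \<i>) * contour_integral (circlepath c \<rho>1) (\<lambda>w. f w / (w - p))))
      (range int \<union> range (\<lambda>n. - int (Suc n)))"
    by (rule has_sum_Un_disjoint[OF nonneg neg]) auto
  moreover have "k \<in> range int \<union> range (\<lambda>n. - int (Suc n))" for k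
    by (cases k) auto
  then have "range int \<union> range (\<lambda>n. - int (Suc n)) = UNIV" by blast
  moreover have "1 / (2 * of_real pi * \<i>) * contour_integral (circlepath c \<rho>2) (\<lambda>w. f w / (w - p)) +
      - (1 / (2 * of_real pi * \<i>) * contour_integral (circlepath c \<rho>1) (\<lambda>w. f w / (w - p))) = f p"
  proof -
    have "1 / (2 * of_real pi * \<i>) * (2 * of_real pi * \<i> * f p) = f p" by simp
    then show ?thesis
      unfolding Cauchy_integral_formula_annulus[OF f r \<rho>1 \<rho>2] by (simp add: algebra_simps)
  qed
  ultimately show "(?t has_sum f p) UNIV" by simp
qed

lemma laurent_coeffs_annulus:
  assumes f: "f holomorphic_on annulus c r R" and r: "0 \<le> r" and \<rho>: "r < \<rho>" "ereal \<rho> < R"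
  shows "laurent_coeffs f c (annulus c r R) = laurent_coeff f c \<rho>"
  unfolding laurent_coeffs_def
proof (rule the_equality[where P = "laurent_series_on f c (annulus c r R)"])
  show "laurent_series_on f c (annulus c r R) (laurent_coeff f c \<rho>)"
    by (rule laurent_series_on_annulus[OF assms])
  show "a = laurent_coeff f c \<rho>" if "laurent_series_on f c (annulus c r R) a" for a
    using laurent_series_on_coeff_unique[OF that sphere_subset_annulus[OF \<rho>]] r \<rho> by auto
qed

text \<open>Turns the projected series into a Cauchy integral. The point p has only to be on the
  correct side of the circle, inside for infinity and outside for a finite puncture, so the formula
  reaches beyond the annulus.\<close>

lemma plus_part_eq_contour_integral:
  assumes f: "(\<lambda>p. f p t) holomorphic_on annulus_at q r R \<alpha> t"
    and r: "0 \<le> r \<alpha> t" and \<rho>: "r \<alpha> t < \<rho>" "ereal \<rho> < R \<alpha> t"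
    and p: "if \<alpha> = 0 then norm p < \<rho> else \<rho> < norm (p - q \<alpha> t)"
  shows "plus_part q r R \<alpha> f p t = (if \<alpha> = 0 then 1 else - 1) *
    (1 / (2 * of_real pi * \<i>) * contour_integral (circlepath (centre q \<alpha> t) \<rho>) (\<lambda>w. f w t / (w - p)))"
proof -
  have "continuous_on (sphere (centre q \<alpha> t) \<rho>) (\<lambda>p. f p t)"
    using f sphere_subset_annulus[OF \<rho>] by (meson continuous_on_subset holomorphic_on_imp_continuous_on)
  note sums = laurent_coeff_outer_sums(1)[OF this] laurent_coeff_inner_sums(1)[OF this]
  show ?thesis
  proof (cases "\<alpha> = 0")
    case True
    with sums(1)[of p] p show ?thesis
      unfolding plus_part_def laurent_coeffs_annulus[OF f r \<rho>] Let_def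
      by (simp add: centre_def sums_iff)
  next
    case False
    with sums(2)[of p] p r \<rho> show ?thesis
      unfolding plus_part_def laurent_coeffs_annulus[OF f r \<rho>] Let_def
      by (simp add: centre_def sums_iff del: of_nat_Suc power_Suc)
  qed
qed

section \<open>Holomorphy of the projections\<close>

lemma with_x_simps [simp]:
  "with_x (with_x t x) y = with_x t y" "with_x t (t 0 1) = t" "with_x t x 0 1 = x"
  "with_x t (t 0 (Suc 0)) = t" "with_x t x 0 (Suc 0) = x"
  by (simp_all add: with_x_def)

text \<open>\<open>px_holomorphic_on\<close> tests each point (p, t) only at x =
  \<open>t 0 1\<close>. Replacing t by \<open>with_x t x\<close> leaves the slice unchanged and
  moves the base point to x, so every point of the slice is tested.\<close>

lemma px_holomorphic_on_iff_slices:
  "px_holomorphic_on f \<Omega> \<longleftrightarrow>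
     (\<forall>t. holomorphic2_on (\<lambda>p x. f p (with_x t x)) {(p, x). (p, with_x t x) \<in> \<Omega>})"
proof
  assume L: "px_holomorphic_on f \<Omega>"
  have "holomorphic2_at (\<lambda>p x. f p (with_x t x)) p x" if "(p, with_x t x) \<in> \<Omega>" for t p x
  proof -
    have "holomorphic2_at (\<lambda>p' x'. f p' (with_x (with_x t x) x')) p (with_x t x 0 1)"
      using L that unfolding px_holomorphic_on_def by fast
    then show ?thesis by simp
  qed
  then show "\<forall>t. holomorphic2_on (\<lambda>p x. f p (with_x t x)) {(p, x). (p, with_x t x) \<in> \<Omega>}"
    unfolding holomorphic2_on_def by auto
next
  assume R: "\<forall>t. holomorphic2_on (\<lambda>p x. f p (with_x t x)) {(p, x). (p, with_x t x) \<in> \<Omega>}"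
  show "px_holomorphic_on f \<Omega>"
    unfolding px_holomorphic_on_def
  proof clarify
    fix p t assume "(p, t) \<in> \<Omega>"
    then have "(p, t 0 1) \<in> {(p, x). (p, with_x t x) \<in> \<Omega>}" by simp
    with R show "holomorphic2_at (\<lambda>p' x. f p' (with_x t x)) p (t 0 1)"
      unfolding holomorphic2_on_def by fast
  qed
qed

lemma px_poisson_with_x:
  "px_poisson f g p (with_x t x) = poisson (\<lambda>p x. f p (with_x t x)) (\<lambda>p x. g p (with_x t x)) p x"
  by (simp add: px_poisson_def)

lemma px_holomorphic_on_poisson:
  assumes "px_open D" "px_holomorphic_on f D" "px_holomorphic_on g D"
  shows "px_holomorphic_on (px_poisson f g) D"
  using assms unfolding px_holomorphic_on_iff_slices px_poisson_with_x px_open_def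
  by (auto intro: holomorphic2_on_poisson)

lemma px_holomorphic_on_sum:
  assumes "px_open D" "\<And>i. i \<in> I \<Longrightarrow> px_holomorphic_on (f i) D"
  shows "px_holomorphic_on (\<lambda>p t. \<Sum>i\<in>I. f i p t) D"
  using assms unfolding px_holomorphic_on_iff_slices px_open_def
  by (auto intro: holomorphic2_on_sum)

lemma px_holomorphic_on_subset: "px_holomorphic_on f A \<Longrightarrow> B \<subseteq> A \<Longrightarrow> px_holomorphic_on f B"
  unfolding px_holomorphic_on_def by blast

lemma holomorphic2_at_snd:
  assumes "g field_differentiable at v"
  shows "holomorphic2_at (\<lambda>u v. g v) u v"
proof -
  obtain d where d: "(g has_derivative (\<lambda>h. d * h)) (at (snd (u, v)))"
    using assms by (auto simp: field_differentiable_def has_field_derivative_def)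
  have "((\<lambda>w. g (snd w)) has_derivative (\<lambda>h. d * snd h)) (at (u, v))"
    by (rule has_derivative_compose[OF has_derivative_snd[OF has_derivative_ident] d])
  then show ?thesis by (intro holomorphic2_atI[of _ 0 d]) simp
qed

lemma holomorphic2_on_fst: "holomorphic2_on (\<lambda>u v. u) U"
proof -
  have "holomorphic2_at (\<lambda>u v. u) u v" for u v
    by (rule holomorphic2_atI[of _ 1 0]) (auto intro!: derivative_eq_intros)
  then show ?thesis unfolding holomorphic2_on_def by blast
qed

text \<open>Locally in x a single radius \<rho> works, and the substitution w = c(x) + \<rho> e^(2
  pi i \<theta>) makes the projection an integral over [0,1] whose integrand is holomorphic in (p,
  x). Differentiability of the centre enters through this substitution.\<close>

lemma plus_part_px_holomorphic:
  assumes q: "\<And>t. t \<in> T \<Longrightarrow> (\<lambda>x. centre q \<alpha> (with_x t x)) field_differentiable at (t 0 1)"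
    and rR: "\<And>t. t \<in> T \<Longrightarrow> 0 \<le> r \<alpha> t \<and> ereal (r \<alpha> t) < R \<alpha> t"
    and op: "px_open {(p, t). t \<in> T \<and> p \<in> annulus_at q r R \<alpha> t}"
    and f: "px_holomorphic_on f {(p, t). t \<in> T \<and> p \<in> annulus_at q r R \<alpha> t}"
  shows "px_holomorphic_on (plus_part q r R \<alpha> f) {(p, t). t \<in> T \<and> p \<in> plus_region q r R \<alpha> t}"
  unfolding px_holomorphic_on_def
proof clarify
  fix p0 t assume t: "t \<in> T" and p0: "p0 \<in> plus_region q r R \<alpha> t"
  define x0 where "x0 = t 0 1"
  have tx0: "with_x t x0 = t" by (simp add: x0_def)
  define c where "c x = centre q \<alpha> (with_x t x)" for x
  define A where "A = {(p, x). with_x t x \<in> T \<and> p \<in> annulus_at q r R \<alpha> (with_x t x)}"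
  define X where "X = {x. with_x t x \<in> T}"
  define g where "g p x = f p (with_x t x)" for p x
  have "open {(p, x). (p, with_x t x) \<in> {(p, t). t \<in> T \<and> p \<in> annulus_at q r R \<alpha> t}}"
    using op unfolding px_open_def by blast
  then have A: "open A" by (simp add: A_def)
  have g: "holomorphic2_on g A"
    using f[unfolded px_holomorphic_on_iff_slices, rule_format, of t] by (simp add: A_def g_def [abs_def])
  have rR': "0 \<le> r \<alpha> (with_x t x)" "ereal (r \<alpha> (with_x t x)) < R \<alpha> (with_x t x)" if "x \<in> X" for x
    using rR that by (auto simp: X_def)
  \<comment> \<open>No annulus is empty, so the admissible x form a projection of the open set
    \<open>A\<close> and are open themselves.\<close>
  have "X = snd ` A"
  proof -
    have "\<exists>p. (p, x) \<in> A" if x: "x \<in> X" for x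
    proof -
      obtain s where "ereal (r \<alpha> (with_x t x)) < ereal s" "ereal s < R \<alpha> (with_x t x)"
        using ereal_dense2[OF rR'(2)[OF x]] by auto
      then have "(c x + of_real s, x) \<in> A"
        using x rR'(1)[OF x] by (simp add: A_def X_def annulus_def c_def)
      then show ?thesis by blast
    qed
    then show ?thesis by (force simp: A_def X_def)
  qed
  then have X: "open X" using A open_image_snd by simp
  have dc: "c field_differentiable at x" if "x \<in> X" for x
    using q[of "with_x t x"] that by (simp add: X_def c_def [abs_def])
  then have cc: "continuous_on X c"
    by (meson continuous_at_imp_continuous_on field_differentiable_imp_continuous_at)
  \<comment> \<open>The circle must lie in the annulus and have \<open>p0\<close> on its proper
    side: \<rho> exceeds \<open>norm p0\<close> at infinity and stays below the distance of
    \<open>p0\<close> from the centre otherwise. Both are possible by the definition of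
    \<open>plus_region\<close>.\<close>
  obtain \<rho> where \<rho>: "r \<alpha> t < \<rho>" "ereal \<rho> < R \<alpha> t"
    "if \<alpha> = 0 then norm (p0 - c x0) < \<rho> else \<rho> < norm (p0 - c x0)"
  proof (cases "\<alpha> = 0")
    case True
    have "max (ereal (r \<alpha> t)) (ereal (norm p0)) < R \<alpha> t"
      using p0 rR[OF t] True by (simp add: plus_region_def)
    then obtain s where "max (ereal (r \<alpha> t)) (ereal (norm p0)) < ereal s" "ereal s < R \<alpha> t"
      using ereal_dense2 by blast
    with that[of s] True show ?thesis by (simp add: c_def centre_def)
  next
    case False
    have "ereal (r \<alpha> t) < min (R \<alpha> t) (ereal (norm (p0 - c x0)))"
      using p0 rR[OF t] False by (simp add: plus_region_def c_def tx0 centre_def)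
    then obtain s where "ereal (r \<alpha> t) < ereal s" "ereal s < min (R \<alpha> t) (ereal (norm (p0 - c x0)))"
      using ereal_dense2 by blast
    with that[of s] False show ?thesis by simp
  qed
  have \<rho>0: "\<rho> > 0" using \<rho> rR[OF t] by auto
  \<comment> \<open>The radii \<open>r\<close> and \<open>R\<close> carry no continuity in x.
    Requiring the one point c(x) + \<rho> to lie in \<open>A\<close> is equivalent to \<rho> being
    admissible at x, and this is visibly an open condition.\<close>
  define X' where "X' = X \<inter> (\<lambda>x. (c x + of_real \<rho>, x)) -` A"
  have X': "open X'"
    unfolding X'_def by (intro continuous_open_preimage continuous_intros cc X A)
  have X'_iff: "x \<in> X' \<longleftrightarrow> x \<in> X \<and> r \<alpha> (with_x t x) < \<rho> \<and> ereal \<rho> < R \<alpha> (with_x t x)" for x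
    using \<rho>0 by (auto simp: X'_def A_def X_def annulus_def c_def)
  have circle: "(c x + circlepath 0 \<rho> \<theta>, x) \<in> A" if "x \<in> X'" for x \<theta>
    using that \<rho>0 circlepath_norm[of \<rho> 0 \<theta>] by (auto simp: X'_iff A_def X_def annulus_def c_def)
  \<comment> \<open>The neighbourhood of (\<open>p0\<close>, \<open>x0\<close>) on which \<rho>
    remains admissible and p remains strictly on its side of the moving circle, so that the kernel
    has no pole.\<close>
  define N where "N = (UNIV \<times> X') \<inter>
    (\<lambda>w. norm (fst w - c (snd w))) -` (if \<alpha> = 0 then {..<\<rho>} else {\<rho><..})"
  have N: "open N"
    unfolding N_def
  proof (rule continuous_open_preimage)
    show "continuous_on (UNIV \<times> X') (\<lambda>w. norm (fst w - c (snd w)))"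
      by (intro continuous_intros continuous_on_compose2[OF cc]) (auto simp: X'_def)
  qed (auto simp: X' open_Times)
  have NX: "x \<in> X'" "x \<in> X" if "(p, x) \<in> N" for p x
    using that by (auto simp: N_def X'_def)
  have ne: "c x + circlepath 0 \<rho> \<theta> - p \<noteq> 0" if "(p, x) \<in> N" for p x \<theta>
  proof
    assume "c x + circlepath 0 \<rho> \<theta> - p = 0"
    then have "p - c x = circlepath 0 \<rho> \<theta>" by (simp add: algebra_simps)
    then have "norm (p - c x) = \<rho>" using circlepath_norm[of \<rho> 0 \<theta>] \<rho>0 by simp
    then show False using that by (auto simp: N_def split: if_splits)
  qed
  define k where "k p x \<theta> = g (c x + circlepath 0 \<rho> \<theta>) x / (c x + circlepath 0 \<rho> \<theta> - p)
    * (2 * of_real pi * \<i> * circlepath 0 \<rho> \<theta>)" for p x \<theta>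
  have "holomorphic2_on (\<lambda>p x. integral (cbox 0 1) (k p x)) N"
  proof (rule holomorphic2_on_param_integral[OF N])
    have gc: "continuous_on A (\<lambda>w. g (fst w) (snd w))"
      using g by (simp add: holomorphic2_on_iff_separately[OF A])
    have c': "continuous_on (N \<times> cbox (0::real) 1) (\<lambda>w. c (snd (fst w)))"
      by (intro continuous_on_compose2[OF cc] continuous_intros) (use NX in force)
    have "continuous_on (N \<times> cbox (0::real) 1)
        (\<lambda>w. g (fst (c (snd (fst w)) + circlepath 0 \<rho> (snd w), snd (fst w)))
               (snd (c (snd (fst w)) + circlepath 0 \<rho> (snd w), snd (fst w))))"
    proof (rule continuous_on_compose2[OF gc])
      show "continuous_on (N \<times> cbox (0::real) 1) (\<lambda>w. (c (snd (fst w)) + circlepath 0 \<rho> (snd w), snd (fst w)))"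
        by (intro continuous_intros c')
      show "(\<lambda>w. (c (snd (fst w)) + circlepath 0 \<rho> (snd w), snd (fst w))) ` (N \<times> cbox (0::real) 1) \<subseteq> A"
        using NX circle by force
    qed
    then show "continuous_on (N \<times> cbox 0 1) (\<lambda>w. k (fst (fst w)) (snd (fst w)) (snd w))"
      unfolding k_def fst_conv snd_conv by (intro continuous_intros c') (use ne in force)+
    fix \<theta> :: real
    have hc: "holomorphic2_on (\<lambda>p x. c x) N"
      unfolding holomorphic2_on_def by (auto intro!: holomorphic2_at_snd dc NX)
    have hc': "holomorphic2_on (\<lambda>p x. c x + circlepath 0 \<rho> \<theta>) N"
      by (intro holomorphic2_on_add[OF N] hc holomorphic2_on_const)
    have "holomorphic2_on (\<lambda>p x. g (c x + circlepath 0 \<rho> \<theta>) x) N"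
      unfolding holomorphic2_on_def
    proof clarify
      fix p x assume px: "(p, x) \<in> N"
      show "holomorphic2_at (\<lambda>p x. g (c x + circlepath 0 \<rho> \<theta>) x) p x"
      proof (rule holomorphic2_at_compose[where f = g and g = "\<lambda>p x. c x + circlepath 0 \<rho> \<theta>" and h = "\<lambda>p x. x"])
        show "holomorphic2_at g (c x + circlepath 0 \<rho> \<theta>) x"
          using g circle[OF NX(1)[OF px]] unfolding holomorphic2_on_def by blast
        show "holomorphic2_at (\<lambda>p x. c x + circlepath 0 \<rho> \<theta>) p x"
          using hc' px unfolding holomorphic2_on_def by blast
        show "holomorphic2_at (\<lambda>p x. x) p x"
          by (rule holomorphic2_at_snd) simp
      qed
    qed
    then show "holomorphic2_on (\<lambda>p x. k p x \<theta>) N"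
      unfolding k_def
      by (intro holomorphic2_on_mult[OF N] holomorphic2_on_divide[OF N] holomorphic2_on_diff[OF N]
          hc' holomorphic2_on_fst holomorphic2_on_const) (use ne in auto)
  qed
  from holomorphic2_on_mult[OF N holomorphic2_on_const this, of "(if \<alpha> = 0 then 1 else - 1) * (1 / (2 * of_real pi * \<i>))"]
  have hol: "holomorphic2_on (\<lambda>p x. (if \<alpha> = 0 then 1 else - 1) * (1 / (2 * of_real pi * \<i>)) * integral (cbox 0 1) (k p x)) N" .
  have eq: "plus_part q r R \<alpha> f p (with_x t x) =
      (if \<alpha> = 0 then 1 else - 1) * (1 / (2 * of_real pi * \<i>)) * integral (cbox 0 1) (k p x)"
    if px: "(p, x) \<in> N" for p x
  proof -
    note x = NX[OF px]
    have "{p. (p, x) \<in> A} = annulus_at q r R \<alpha> (with_x t x)"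
      using x by (auto simp: A_def X_def)
    moreover have "(\<lambda>p. g p x) holomorphic_on {p. (p, x) \<in> A}"
      using g unfolding holomorphic2_on_iff_separately[OF A] by blast
    ultimately have "(\<lambda>p. f p (with_x t x)) holomorphic_on annulus_at q r R \<alpha> (with_x t x)"
      by (simp add: g_def)
    moreover have "if \<alpha> = 0 then norm p < \<rho> else \<rho> < norm (p - q \<alpha> (with_x t x))"
      using px by (auto simp: N_def c_def centre_def split: if_splits)
    ultimately have "plus_part q r R \<alpha> f p (with_x t x) = (if \<alpha> = 0 then 1 else - 1) *
      (1 / (2 * of_real pi * \<i>) * contour_integral (circlepath (c x) \<rho>) (\<lambda>w. g w x / (w - p)))"
      unfolding c_def g_def using x rR'(1)[OF x(2)]
      by (intro plus_part_eq_contour_integral) (auto simp: X'_iff)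
    moreover have "contour_integral (circlepath (c x) \<rho>) (\<lambda>w. g w x / (w - p)) = integral (cbox 0 1) (k p x)"
      unfolding circlepath_integral_01 k_def circlepath_shift[of "c x"] by simp
    ultimately show ?thesis by (simp only: mult.assoc)
  qed
  have "(p0, x0) \<in> N"
    using \<rho> t by (auto simp: N_def X'_iff X_def tx0)
  then have "holomorphic2_at (\<lambda>p x. plus_part q r R \<alpha> f p (with_x t x)) p0 x0 \<longleftrightarrow>
    holomorphic2_at (\<lambda>p x. (if \<alpha> = 0 then 1 else - 1) * (1 / (2 * of_real pi * \<i>)) * integral (cbox 0 1) (k p x)) p0 x0"
    by (rule holomorphic2_at_cong[OF N]) (rule eq)
  moreover have "holomorphic2_at (\<lambda>p x. (if \<alpha> = 0 then 1 else - 1) * (1 / (2 * of_real pi * \<i>)) * integral (cbox 0 1) (k p x)) p0 x0"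
    using bspec[OF hol[unfolded holomorphic2_on_def] \<open>(p0, x0) \<in> N\<close>] by simp
  ultimately have "holomorphic2_at (\<lambda>p x. plus_part q r R \<alpha> f p (with_x t x)) p0 x0" ..
  then show "holomorphic2_at (\<lambda>p x. plus_part q r R \<alpha> f p (with_x t x)) p0 (t 0 1)"
    by (simp add: x0_def)
qed

section \<open>The deformation to first order\<close>

text \<open>Taylor's formula with remainder; the constant is a bound for the second derivative on a
  closed disc, available by compactness.\<close>

lemma holomorphic_on_first_order_bigo:
  assumes E: "open E" "0 \<in> E" and k: "k holomorphic_on E" and d: "(k has_field_derivative d) (at 0)"
  shows "(\<lambda>\<epsilon>. k \<epsilon> - (k 0 + \<epsilon> * d)) \<in> O[at 0](\<lambda>\<epsilon>. \<epsilon> ^ 2)"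
proof -
  obtain \<delta> where \<delta>: "\<delta> > 0" "cball 0 \<delta> \<subseteq> E" using E open_contains_cball by blast
  have k': "deriv k holomorphic_on E" "deriv (deriv k) holomorphic_on E"
    using k E by (auto intro!: holomorphic_deriv)
  have "compact (deriv (deriv k) ` cball 0 \<delta>)"
    using k'(2) \<delta> by (intro compact_continuous_image compact_cball)
      (auto intro: holomorphic_on_imp_continuous_on holomorphic_on_subset)
  then have "bounded (deriv (deriv k) ` cball 0 \<delta>)" by (rule compact_imp_bounded)
  then obtain B where "\<forall>y\<in>deriv (deriv k) ` cball 0 \<delta>. norm y \<le> B" unfolding bounded_iff ..
  then have B: "norm (deriv (deriv k) x) \<le> B" if "x \<in> cball 0 \<delta>" for x using that by blast
  have "norm (k \<epsilon> - (k 0 + \<epsilon> * d)) \<le> B * norm (\<epsilon> ^ 2)" if \<epsilon>: "\<epsilon> \<in> cball 0 \<delta>" for \<epsilon>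
  proof -
    \<comment> \<open>Order 1 in \<open>complex_Taylor\<close>: \<open>Suc 1\<close> is the exponent
      2 and \<open>fact 1\<close> is 1, so \<open>B\<close> itself is the constant.\<close>
    have "norm ((deriv ^^ 0) k \<epsilon> - (\<Sum>i\<le>1. (deriv ^^ i) k 0 * (\<epsilon> - 0) ^ i / fact i)) \<le> B * norm (\<epsilon> - 0) ^ Suc 1 / fact 1"
    proof (rule complex_Taylor[OF convex_cball])
      fix i :: nat and x :: complex assume "x \<in> cball 0 \<delta>" "i \<le> 1"
      then have x: "x \<in> E" using \<delta> by blast
      have "(deriv ^^ i) k holomorphic_on E" by (intro holomorphic_higher_deriv k E)
      from holomorphic_derivI[OF this E(1) x] show "((deriv ^^ i) k has_field_derivative (deriv ^^ Suc i) k x) (at x within cball 0 \<delta>)"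
        by (simp add: has_field_derivative_at_within)
    qed (use B \<epsilon> \<delta> in \<open>auto simp: numeral_2_eq_2\<close>)
    then show ?thesis
      using DERIV_imp_deriv[OF d] by (simp add: norm_mult power2_eq_square mult_ac)
  qed
  moreover have "eventually (\<lambda>\<epsilon>. \<epsilon> \<in> cball 0 \<delta>) (at 0)"
    using \<delta> by (auto simp: eventually_at intro!: exI[of _ \<delta>] simp: dist_commute)
  ultimately show ?thesis by (intro bigoI[of _ B]) (auto elim: eventually_mono)
qed

text \<open>For fixed (p, t) the deformation moves the point (z, m) along a complex line with
  direction (a, b), which reduces the expansion in \<epsilon> to one variable.\<close>

lemma holomorphic2_on_line:
  fixes z m a b :: complex
  assumes W: "open W" and f: "holomorphic2_on f W"
  defines "E \<equiv> {\<epsilon>. (z + \<epsilon> * a, m + \<epsilon> * b) \<in> W}"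
  shows "open E" "(\<lambda>\<epsilon>. f (z + \<epsilon> * a) (m + \<epsilon> * b)) holomorphic_on E"
    "0 \<in> E \<Longrightarrow> ((\<lambda>\<epsilon>. f (z + \<epsilon> * a) (m + \<epsilon> * b)) has_field_derivative
       deriv (\<lambda>s. f s m) z * a + deriv (\<lambda>s. f z s) m * b) (at 0)"
proof -
  have "open ((\<lambda>\<epsilon>. (z + \<epsilon> * a, m + \<epsilon> * b)) -` W)"
    by (intro open_vimage[OF W] continuous_intros)
  then show E: "open E" by (simp add: E_def vimage_def)
  have d: "((\<lambda>\<epsilon>. f (z + \<epsilon> * a) (m + \<epsilon> * b)) has_field_derivative
       deriv (\<lambda>s. f s (m + \<epsilon> * b)) (z + \<epsilon> * a) * a + deriv (\<lambda>s. f (z + \<epsilon> * a) s) (m + \<epsilon> * b) * b) (at \<epsilon>)"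
    if "\<epsilon> \<in> E" for \<epsilon>
  proof -
    have "holomorphic2_at f (z + \<epsilon> * a) (m + \<epsilon> * b)"
      using f that unfolding holomorphic2_on_def E_def by blast
    note f' = holomorphic2_at_has_derivative[OF this]
    have l: "((\<lambda>\<epsilon>. (z + \<epsilon> * a, m + \<epsilon> * b)) has_derivative (\<lambda>h. (h * a, h * b))) (at \<epsilon>)"
      by (auto intro!: derivative_eq_intros)
    show ?thesis
      unfolding has_field_derivative_def
      by (rule has_derivative_eq_rhs[OF has_derivative_compose[OF l, of "\<lambda>w. f (fst w) (snd w)", simplified, OF f']])
        (simp add: fun_eq_iff algebra_simps)
  qed
  then show "(\<lambda>\<epsilon>. f (z + \<epsilon> * a) (m + \<epsilon> * b)) holomorphic_on E"
    using E by (auto simp: holomorphic_on_open)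
  show "0 \<in> E \<Longrightarrow> ((\<lambda>\<epsilon>. f (z + \<epsilon> * a) (m + \<epsilon> * b)) has_field_derivative
       deriv (\<lambda>s. f s m) z * a + deriv (\<lambda>s. f z s) m * b) (at 0)"
    using d[of 0] by simp
qed

text \<open>In the variables of \<open>W\<close> the contribution of F to (a, b) is the Hamiltonian
  field (\<open>F2\<close>, -\<open>F1\<close>). Along it P changes by exactly -{F, P}, which the
  explicit term \<epsilon> {F, P} compensates, so only the contribution of S is left.\<close>

lemma deformation_first_order:
  assumes W: "open W" and F: "holomorphic2_on F W" and P: "holomorphic2_on P W"
    and Z: "holomorphic2_at Z u v" and Y: "holomorphic2_at Y u v" and S: "holomorphic2_at S u v"
    and mem: "(Z u v, Y u v) \<in> W" and canon: "poisson Z Y u v = 1"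
  defines "G \<equiv> \<lambda>u v. F (Z u v) (Y u v) - S u v"
  defines "a \<equiv> poisson Z G u v" and "b \<equiv> poisson Y G u v"
  shows "(\<lambda>\<epsilon>. P (Z u v + \<epsilon> * a) (Y u v + \<epsilon> * b) + \<epsilon> * poisson F P (Z u v + \<epsilon> * a) (Y u v + \<epsilon> * b)
      - (P (Z u v) (Y u v) + \<epsilon> * poisson S (\<lambda>u v. P (Z u v) (Y u v)) u v)) \<in> O[at 0](\<lambda>\<epsilon>. \<epsilon> ^ 2)"
proof -
  define E where "E = {\<epsilon>. (Z u v + \<epsilon> * a, Y u v + \<epsilon> * b) \<in> W}"
  have E0: "0 \<in> E" using mem by (simp add: E_def)
  have FP: "holomorphic2_on (poisson F P) W" by (rule holomorphic2_on_poisson[OF W F P])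
  note lP = holomorphic2_on_line[OF W P, of "Z u v" a "Y u v" b, folded E_def]
  note lFP = holomorphic2_on_line[OF W FP, of "Z u v" a "Y u v" b, folded E_def]
  define k where "k \<epsilon> = P (Z u v + \<epsilon> * a) (Y u v + \<epsilon> * b) + \<epsilon> * poisson F P (Z u v + \<epsilon> * a) (Y u v + \<epsilon> * b)" for \<epsilon>
  define P1 where "P1 = deriv (\<lambda>s. P s (Y u v)) (Z u v)"
  define P2 where "P2 = deriv (\<lambda>s. P (Z u v) s) (Y u v)"
  define F1 where "F1 = deriv (\<lambda>s. F s (Y u v)) (Z u v)"
  define F2 where "F2 = deriv (\<lambda>s. F (Z u v) s) (Y u v)"
  define Z1 where "Z1 = deriv (\<lambda>s. Z s v) u"
  define Z2 where "Z2 = deriv (\<lambda>s. Z u s) v"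
  define Y1 where "Y1 = deriv (\<lambda>s. Y s v) u"
  define Y2 where "Y2 = deriv (\<lambda>s. Y u s) v"
  define S1 where "S1 = deriv (\<lambda>s. S s v) u"
  define S2 where "S2 = deriv (\<lambda>s. S u s) v"
  note defs = P1_def P2_def F1_def F2_def Z1_def Z2_def Y1_def Y2_def S1_def S2_def
  have Pat: "holomorphic2_at P (Z u v) (Y u v)" and Fat: "holomorphic2_at F (Z u v) (Y u v)"
    using P F mem unfolding holomorphic2_on_def by blast+
  note dP = has_derivative2_imp_partials[of "\<lambda>u v. P (Z u v) (Y u v)", OF has_derivative2_compose[OF Pat Z Y], folded defs]
  note dF = has_derivative2_imp_partials[of "\<lambda>u v. F (Z u v) (Y u v)", OF has_derivative2_compose[OF Fat Z Y], folded defs]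
  note dS = holomorphic2_at_partials[OF S, folded defs]
  have G1: "deriv (\<lambda>s. G s v) u = F1 * Z1 + F2 * Y1 - S1" and G2: "deriv (\<lambda>s. G u s) v = F1 * Z2 + F2 * Y2 - S2"
    unfolding G_def
    by (rule DERIV_imp_deriv[OF DERIV_diff[OF dF(1) dS(1)]], rule DERIV_imp_deriv[OF DERIV_diff[OF dF(2) dS(2)]])
  \<comment> \<open>Solved for one product so that the factor \<open>Z1 * Y2 - Z2 * Y1\<close> in
    \<open>a\<close> and \<open>b\<close> simplifies to 1.\<close>
  have can: "Z1 * Y2 = 1 + Z2 * Y1"
    using canon unfolding poisson_def defs[symmetric] by (simp add: algebra_simps)
  have a: "a = F2 - (Z1 * S2 - Z2 * S1)"
  proof -
    have "a = F2 * (Z1 * Y2 - Z2 * Y1) - (Z1 * S2 - Z2 * S1)"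
      unfolding a_def poisson_def G1 G2 defs[symmetric] by (simp add: algebra_simps)
    then show ?thesis by (simp add: can)
  qed
  have b: "b = - F1 - (Y1 * S2 - Y2 * S1)"
  proof -
    have "b = - F1 * (Z1 * Y2 - Z2 * Y1) - (Y1 * S2 - Y2 * S1)"
      unfolding b_def poisson_def G1 G2 defs[symmetric] by (simp add: algebra_simps)
    then show ?thesis by (simp add: can)
  qed
  have pFP: "poisson F P (Z u v) (Y u v) = F1 * P2 - F2 * P1"
    by (simp add: poisson_def defs)
  have pS: "poisson S (\<lambda>u v. P (Z u v) (Y u v)) u v = S1 * (P1 * Z2 + P2 * Y2) - S2 * (P1 * Z1 + P2 * Y1)"
    unfolding poisson_def DERIV_imp_deriv[OF dP(1)] DERIV_imp_deriv[OF dP(2)] S1_def S2_def ..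
  have "(k has_field_derivative poisson S (\<lambda>u v. P (Z u v) (Y u v)) u v) (at 0)"
  proof -
    \<comment> \<open>In the product rule the derivative of {F, P} along the line is multiplied by
      \<epsilon> = 0. Evaluating the bracket at the displaced point thus affects only the second
      order.\<close>
    have "(k has_field_derivative (P1 * a + P2 * b) + (1 * poisson F P (Z u v + 0 * a) (Y u v + 0 * b) +
        (deriv (\<lambda>s. poisson F P s (Y u v)) (Z u v) * a + deriv (poisson F P (Z u v)) (Y u v) * b) * 0)) (at 0)"
      unfolding k_def [abs_def] P1_def P2_def
      by (intro DERIV_add DERIV_mult lP(3)[OF E0] lFP(3)[OF E0] DERIV_ident)
    moreover have "(P1 * a + P2 * b) + (1 * poisson F P (Z u v + 0 * a) (Y u v + 0 * b) +
        (deriv (\<lambda>s. poisson F P s (Y u v)) (Z u v) * a + deriv (poisson F P (Z u v)) (Y u v) * b) * 0)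
      = poisson S (\<lambda>u v. P (Z u v) (Y u v)) u v"
      unfolding pS by (simp add: pFP, simp add: a b algebra_simps)
    ultimately show ?thesis by (simp only:)
  qed
  moreover have "k holomorphic_on E"
    unfolding k_def [abs_def] by (intro holomorphic_intros lP lFP)
  ultimately have "(\<lambda>\<epsilon>. k \<epsilon> - (k 0 + \<epsilon> * poisson S (\<lambda>u v. P (Z u v) (Y u v)) u v)) \<in> O[at 0](\<lambda>\<epsilon>. \<epsilon> ^ 2)"
    using E0 lP(1) by (intro holomorphic_on_first_order_bigo)
  then show ?thesis by (simp add: k_def)
qed

text \<open>With H the common continuation of the undeformed functions, the witnesses are H and {S,
  H}; neither mentions the puncture. One function family suffices here, so the same argument serves
  both P and Q.\<close>

lemma deformed_equal_to_first_order:
  assumes wv: "whitham_variables M T q r R \<Omega> z m"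
    and cd: "continuation_domain M T q r R \<Omega> D"
    and W: "\<forall>\<alpha> \<le> M. open (W \<alpha>)"
    and zm: "\<forall>\<alpha> \<le> M. \<forall>(p, t) \<in> \<Omega> \<alpha>. (z \<alpha> p t, m \<alpha> p t) \<in> W \<alpha>"
    and F: "\<forall>\<alpha> \<le> M. holomorphic2_on (F \<alpha>) (W \<alpha>)"
    and P: "\<forall>\<alpha> \<le> M. holomorphic2_on (P \<alpha>) (W \<alpha>)"
    and ij: "i \<le> M" "j \<le> M"
    and eq: "equal_by_continuation D (\<Omega> i) (\<lambda>p t. P i (z i p t) (m i p t))
                                     (\<Omega> j) (\<lambda>p t. P j (z j p t) (m j p t))"
  shows "equal_to_first_order D (\<Omega> i) (deformed M q r R z m F P i) (\<Omega> j) (deformed M q r R z m F P j)"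
proof -
  define S where "S p t = (\<Sum>\<beta>\<le>M. plus_part q r R \<beta> (\<lambda>p t. F \<beta> (z \<beta> p t) (m \<beta> p t)) p t)" for p t
  have dq: "\<forall>i \<in> {1..M}. \<forall>t \<in> T. (\<lambda>x. q i (with_x t x)) field_differentiable at (t 0 1)"
    and rR: "\<forall>\<alpha> \<le> M. \<forall>t \<in> T. 0 \<le> r \<alpha> t \<and> ereal (r \<alpha> t) < R \<alpha> t"
    and opA: "\<forall>\<alpha> \<le> M. px_open {(p, t). t \<in> T \<and> p \<in> annulus_at q r R \<alpha> t}"
    and \<Omega>: "\<forall>\<alpha> \<le> M. {(p, t). t \<in> T \<and> p \<in> annulus_at q r R \<alpha> t} \<subseteq> \<Omega> \<alpha> \<and>
               \<Omega> \<alpha> \<subseteq> UNIV \<times> T \<and> px_open (\<Omega> \<alpha>)"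
    and hol: "\<forall>\<alpha> \<le> M. px_holomorphic_on (z \<alpha>) (\<Omega> \<alpha>) \<and> px_holomorphic_on (m \<alpha>) (\<Omega> \<alpha>)"
    and canon: "\<forall>\<alpha> \<le> M. \<forall>(p, t) \<in> \<Omega> \<alpha>. px_poisson (z \<alpha>) (m \<alpha>) p t = 1"
    using wv unfolding whitham_variables_def by simp_all
  have D: "px_open D" "D \<subseteq> UNIV \<times> T" "\<forall>\<alpha> \<le> M. \<Omega> \<alpha> \<subseteq> D"
    "\<forall>\<alpha> \<le> M. \<forall>(p, t) \<in> D. p \<in> plus_region q r R \<alpha> t"
    using cd unfolding continuation_domain_def by simp_all
  obtain H where H: "px_holomorphic_on H D"
    and Hi: "\<forall>(p, t) \<in> \<Omega> i. P i (z i p t) (m i p t) = H p t"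
    and Hj: "\<forall>(p, t) \<in> \<Omega> j. P j (z j p t) (m j p t) = H p t"
    using eq unfolding equal_by_continuation_def by blast
  \<comment> \<open>Each summand is holomorphic where its own projected series is controlled, namely
    on its \<open>plus_region\<close>; D lies in all of these regions at once.\<close>
  have S: "px_holomorphic_on S D"
    unfolding S_def [abs_def]
  proof (rule px_holomorphic_on_sum[OF D(1)])
    fix \<beta> assume "\<beta> \<in> {..M}"
    then have \<beta>: "\<beta> \<le> M" by simp
    have "px_holomorphic_on (\<lambda>p t. F \<beta> (z \<beta> p t) (m \<beta> p t)) (\<Omega> \<beta>)"
      unfolding px_holomorphic_on_def
    proof clarify
      fix p t assume pt: "(p, t) \<in> \<Omega> \<beta>"
      show "holomorphic2_at (\<lambda>p x. F \<beta> (z \<beta> p (with_x t x)) (m \<beta> p (with_x t x))) p (t 0 1)"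
      proof (rule holomorphic2_at_compose[where f = "F \<beta>" and g = "\<lambda>p x. z \<beta> p (with_x t x)"
            and h = "\<lambda>p x. m \<beta> p (with_x t x)"])
        show "holomorphic2_at (F \<beta>) (z \<beta> p (with_x t (t 0 1))) (m \<beta> p (with_x t (t 0 1)))"
          using F zm pt \<beta> unfolding holomorphic2_on_def by fastforce
      qed (use hol pt \<beta> in \<open>auto simp: px_holomorphic_on_def\<close>)
    qed
    then have f: "px_holomorphic_on (\<lambda>p t. F \<beta> (z \<beta> p t) (m \<beta> p t)) {(p, t). t \<in> T \<and> p \<in> annulus_at q r R \<beta> t}"
      using \<Omega> \<beta> px_holomorphic_on_subset by blast
    \<comment> \<open>At infinity the centre is the constant 0; at a finite puncture it is the
      moving point q, differentiable in x by hypothesis.\<close>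
    have c: "(\<lambda>x. centre q \<beta> (with_x t x)) field_differentiable at (t 0 1)" if "t \<in> T" for t
      using dq \<beta> that by (cases "\<beta> = 0") (auto simp: centre_def)
    have "px_holomorphic_on (plus_part q r R \<beta> (\<lambda>p t. F \<beta> (z \<beta> p t) (m \<beta> p t)))
        {(p, t). t \<in> T \<and> p \<in> plus_region q r R \<beta> t}"
    proof (rule plus_part_px_holomorphic)
      show "(\<lambda>x. centre q \<beta> (with_x t x)) field_differentiable at (t 0 1)" if "t \<in> T" for t
        using that by (rule c)
    qed (use f rR opA \<beta> in auto)
    moreover have "D \<subseteq> {(p, t). t \<in> T \<and> p \<in> plus_region q r R \<beta> t}"
      using D \<beta> by blast
    ultimately show "px_holomorphic_on (plus_part q r R \<beta> (\<lambda>p t. F \<beta> (z \<beta> p t) (m \<beta> p t))) D"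
      using px_holomorphic_on_subset by blast
  qed
  have main: "(\<lambda>\<epsilon>. deformed M q r R z m F P \<alpha> \<epsilon> p t - (H p t + \<epsilon> * px_poisson S H p t)) \<in> O[at 0](\<lambda>\<epsilon>. \<epsilon> ^ 2)"
    if \<alpha>: "\<alpha> \<le> M" and HP: "\<forall>(p, t) \<in> \<Omega> \<alpha>. P \<alpha> (z \<alpha> p t) (m \<alpha> p t) = H p t" and pt: "(p, t) \<in> \<Omega> \<alpha>"
    for \<alpha> p t
  proof -
    define Z where "Z p x = z \<alpha> p (with_x t x)" for p x
    define Y where "Y p x = m \<alpha> p (with_x t x)" for p x
    define S' where "S' p x = S p (with_x t x)" for p x
    define V where "V = {(p, x). (p, with_x t x) \<in> \<Omega> \<alpha>}"
    have V: "open V" "(p, t 0 1) \<in> V"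
      using \<Omega> \<alpha> pt by (auto simp: V_def px_open_def)
    have hz: "holomorphic2_at Z p (t 0 1)" "holomorphic2_at Y p (t 0 1)"
      using hol \<alpha> pt by (auto simp: px_holomorphic_on_def Z_def [abs_def] Y_def [abs_def])
    have hS: "holomorphic2_at S' p (t 0 1)"
      using S D(3) \<alpha> pt by (auto simp: px_holomorphic_on_def S'_def [abs_def])
    have mem: "(Z p (t 0 1), Y p (t 0 1)) \<in> W \<alpha>"
      using zm \<alpha> pt by (auto simp: Z_def Y_def)
    have can: "poisson Z Y p (t 0 1) = 1"
      using canon \<alpha> pt by (auto simp: px_poisson_def Z_def [abs_def] Y_def [abs_def])
    have "H p t = P \<alpha> (Z p (t 0 1)) (Y p (t 0 1))"
      using HP pt by (auto simp: Z_def Y_def)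
    \<comment> \<open>H coincides with the composite of P only on the domain attached to this
      puncture; that domain has open slices, which is enough for the brackets to agree.\<close>
    moreover have "px_poisson S H p t = poisson S' (\<lambda>p x. P \<alpha> (Z p x) (Y p x)) p (t 0 1)"
      unfolding px_poisson_def
      by (rule poisson_cong[OF V]) (use HP in \<open>auto simp: S'_def V_def Z_def Y_def\<close>)
    moreover have "deformed M q r R z m F P \<alpha> \<epsilon> p t =
        (let G = \<lambda>u v. F \<alpha> (Z u v) (Y u v) - S' u v;
             u = Z p (t 0 1) + \<epsilon> * poisson Z G p (t 0 1);
             w = Y p (t 0 1) + \<epsilon> * poisson Y G p (t 0 1)
         in P \<alpha> u w + \<epsilon> * poisson (F \<alpha>) (P \<alpha>) u w)" for \<epsilon>
      unfolding deformed_def px_poisson_def minus_part_def Let_def Z_def Y_def S'_def S_def by simp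
    ultimately show ?thesis
      using deformation_first_order[OF _ _ _ hz hS mem can, of "F \<alpha>" "P \<alpha>"] W F P \<alpha>
      by (simp add: Let_def)
  qed
  show ?thesis
    unfolding equal_to_first_order_def
  proof (intro exI conjI)
    show "px_holomorphic_on H D" by (rule H)
    show "px_holomorphic_on (px_poisson S H) D" by (rule px_holomorphic_on_poisson[OF D(1) S H])
  qed (use main[OF ij(1) Hi] main[OF ij(2) Hj] in auto)
qed

theorem theorem2:
  fixes M :: nat
    and T :: "times set"
    and q :: "nat \<Rightarrow> times \<Rightarrow> complex"
    and r :: "nat \<Rightarrow> times \<Rightarrow> real"
    and R :: "nat \<Rightarrow> times \<Rightarrow> ereal"
    and \<Omega> :: "nat \<Rightarrow> (complex \<times> times) set"
    and z m :: "nat \<Rightarrow> complex \<Rightarrow> times \<Rightarrow> complex"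
    and D :: "(complex \<times> times) set"
    and W :: "nat \<Rightarrow> (complex \<times> complex) set"
    and P Q F :: "nat \<Rightarrow> complex \<Rightarrow> complex \<Rightarrow> complex"
  assumes "whitham_variables M T q r R \<Omega> z m"
    and "continuation_domain M T q r R \<Omega> D"
    and "\<forall>\<alpha> \<le> M. open (W \<alpha>)"
    and "\<forall>\<alpha> \<le> M. \<forall>(p, t) \<in> \<Omega> \<alpha>. (z \<alpha> p t, m \<alpha> p t) \<in> W \<alpha>"
    and "\<forall>\<alpha> \<le> M. canonically_conjugate (W \<alpha>) (P \<alpha>) (Q \<alpha>)"
    and "\<forall>\<alpha> \<le> M. holomorphic2_on (F \<alpha>) (W \<alpha>)"
    and "string_equations M D \<Omega> z m P Q"
  shows "\<forall>i \<in> {1..M}.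
           equal_to_first_order D (\<Omega> i) (deformed M q r R z m F P i)
                                  (\<Omega> 0) (deformed M q r R z m F P 0) \<and>
           equal_to_first_order D (\<Omega> i) (deformed M q r R z m F Q i)
                                  (\<Omega> 0) (deformed M q r R z m F Q 0)"
proof
  fix i assume i: "i \<in> {1..M}"
  have P: "\<forall>\<alpha> \<le> M. holomorphic2_on (P \<alpha>) (W \<alpha>)" and Q: "\<forall>\<alpha> \<le> M. holomorphic2_on (Q \<alpha>) (W \<alpha>)"
    using assms(5) by (auto simp: canonically_conjugate_def)
  from assms(7) i show "equal_to_first_order D (\<Omega> i) (deformed M q r R z m F P i)
      (\<Omega> 0) (deformed M q r R z m F P 0) \<and>
    equal_to_first_order D (\<Omega> i) (deformed M q r R z m F Q i)
      (\<Omega> 0) (deformed M q r R z m F Q 0)"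
    unfolding string_equations_def
    by (intro conjI deformed_equal_to_first_order[OF assms(1-4,6) P]
        deformed_equal_to_first_order[OF assms(1-4,6) Q]) auto
qed

end
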